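(* Let $G=(V,E)$ be a finite decomposable graph, $r\in\{1,2,\ldots\}$ and $s>0$. 1) For $n\in\mathbb N^V$, $$\binom{r}{n}_G=\frac{\prod_{C\in\mathcal C_G^+}\binom{r}{n_C}}{\prod_{S\in\mathcal S_G^-}\binom{r}{n_S}^{\nu_S}}\qquad\text{and}\qquad \genfrac{[}{]}{0pt}{}{|n|+s-1}{n}_G=\frac{\prod_{C\in\mathcal C_G^+}\binom{|n_C|+s-1}{n_C}}{\prod_{S\in\mathcal S_G^-}\binom{|n_S|+s-1}{n_S}^{\nu_S}},$$ where the first quotient is read as $0$ if its denominator vanishes. 2) Let $\mathcal G$, with parent function $\mathfrak{pa}$, be a moral DAG with skeleton $G$. Then, for $n\in\mathbb N^V$, $$\binom{r}{n}_G=\prod_{i\in V}\binom{r-|n_{\mathfrak{pa}(i)}|}{n_i}\qquad\text{and}\qquad \genfrac{[}{]}{0pt}{}{|n|+s-1}{n}_G=\prod_{i\in V}\binom{n_i+|n_{\mathfrak{pa}(i)}|+s-1}{n_i}.$$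
   Context: $\mathbb N=\{0,1,2,\ldots\}$. $G=(V,E)$ is a finite undirected simple graph; $G^*$ its complement graph. A clique is a set of pairwise adjacent vertices ($\emptyset$ and singletons are cliques); $\mathcal C_G$ is the set of cliques and $\mathcal C_G^+$ the set of maximal cliques. $G$ is decomposable iff it is chordal (no induced cycle of length greater than 3); it may be disconnected. Minimal separators: the maximal cliques of a decomposable graph admit a perfect ordering $C_1,\ldots,C_K$, i.e. for each $k\ge2$ there is $\ell<k$ with $S_k:=C_k\cap(C_1\cup\cdots\cup C_{k-1})\subset C_\ell$. $\mathcal S_G^-$ is the set of nonempty sets among $S_2,\ldots,S_K$, and $\nu_S$ is the number of $k$ with $S_k=S$; these do not depend on the perfect ordering. A moral DAG with skeleton $G$ is an orientation of all edges of $G$ without directed cycles such that any two distinct parents of a common vertex are adjacent; $\mathfrak{pa}(i)=\{j:j\to i\}$. $\Delta_G(x)=\sum_{C\in\mathcal C_{G^*}}(-1)^{|C|}\prod_{i\in C}x_i$, $\delta_G(y)=\sum_{C\in\mathcal C_{G^*}}\prod_{i\in C}y_i$. The graph-multinomial coefficients are defined by $\delta_G(y)^r=\sum_{n\in\mathbb N^V}\binom{r}{n}_G y^n$ (integer $r\ge1$) and by the formal power series $\Delta_G(x)^{-s}=\sum_{n\in\mathbb N^V}\genfrac{[}{]}{0pt}{}{|n|+s-1}{n}_G x^n$ (real $s>0$), where $x^n=\prod_{i\in V} x_i^{n_i}$. For $A\subset V$, $n_A=(n_i)_{i\in A}$, $|n_A|=\sum_{i\in A}n_i$, $|n|=|n_V|$.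 Ordinary coefficients: $\binom{r}{n_A}=\frac{r!}{(r-|n_A|)!\prod_{i\in A}n_i!}$ if $|n_A|\le r$ and $0$ otherwise; $\binom{|n_A|+s-1}{n_A}=\frac{\Gamma(|n_A|+s)}{\Gamma(s)\prod_{i\in A}n_i!}$; for an integer $a$ and $b\in\mathbb N$, $\binom ab$ is the usual binomial coefficient, with $\binom ab=0$ if $a<0$ or $b>a$; for real $a>b-1$, $\binom ab=\frac{\Gamma(a+1)}{b!\,\Gamma(a-b+1)}$. *)

theory Defs
  imports "HOL-Analysis.Analysis" "HOL-Library.Poly_Mapping"
begin

section \<open>Graphs\<close>

text \<open>A graph is given by its vertex set \<open>V\<close> and its set \<open>E\<close> of two-element edges.\<close>

definition finite_simple_graph :: "'a set \<Rightarrow> 'a set set \<Rightarrow> bool" where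
  "finite_simple_graph V E \<longleftrightarrow> finite V \<and> (\<forall>e\<in>E. e \<subseteq> V \<and> card e = 2)"

definition complement_edges :: "'a set \<Rightarrow> 'a set set \<Rightarrow> 'a set set" where
  "complement_edges V E = {e. e \<subseteq> V \<and> card e = 2 \<and> e \<notin> E}"

definition cliques :: "'a set \<Rightarrow> 'a set set \<Rightarrow> 'a set set" where
  "cliques V E = {C. C \<subseteq> V \<and> (\<forall>i\<in>C. \<forall>j\<in>C. i \<noteq> j \<longrightarrow> {i, j} \<in> E)}"

definition max_cliques :: "'a set \<Rightarrow> 'a set set \<Rightarrow> 'a set set" where
  "max_cliques V E = {C \<in> cliques V E. \<forall>D\<in>cliques V E. C \<subseteq> D \<longrightarrow> D = C}"

text \<open>The list \<open>p\<close> enumerates the vertices of an induced cycle in cyclic order. This describes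
  a cycle only for lists of length at least 3, and it is only used for length greater than 3.\<close>

definition induced_cycle :: "'a set \<Rightarrow> 'a set set \<Rightarrow> 'a list \<Rightarrow> bool" where
  "induced_cycle V E p \<longleftrightarrow> distinct p \<and> set p \<subseteq> V \<and>
     (\<forall>i<length p. \<forall>j<length p.
        {p ! i, p ! j} \<in> E \<longleftrightarrow> j = Suc i mod length p \<or> i = Suc j mod length p)"

definition decomposable :: "'a set \<Rightarrow> 'a set set \<Rightarrow> bool" where
  "decomposable V E \<longleftrightarrow> (\<nexists>p. induced_cycle V E p \<and> length p > 3)"

section \<open>Perfect orderings and minimal separators\<close>

text \<open>Lists are indexed from 0, so \<open>clique_sep Cs k\<close> is $S_{k+1}$ in one-based numbering, and
  the separators are those with \<open>1 \<le> k < length Cs\<close>.\<close>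

definition clique_sep :: "'a set list \<Rightarrow> nat \<Rightarrow> 'a set" where
  "clique_sep Cs k = Cs ! k \<inter> (\<Union>l<k. Cs ! l)"

definition perfect_ordering :: "'a set \<Rightarrow> 'a set set \<Rightarrow> 'a set list \<Rightarrow> bool" where
  "perfect_ordering V E Cs \<longleftrightarrow> distinct Cs \<and> set Cs = max_cliques V E \<and>
     (\<forall>k\<in>{1..<length Cs}. \<exists>l<k. clique_sep Cs k \<subseteq> Cs ! l)"

text \<open>A decomposable graph has a perfect ordering, and the separators with their multiplicities
  do not depend on it. They are therefore read off from an arbitrarily chosen one, the same one
  for both definitions.\<close>

definition some_perfect_ordering :: "'a set \<Rightarrow> 'a set set \<Rightarrow> 'a set list" where
  "some_perfect_ordering V E = (SOME Cs. perfect_ordering V E Cs)"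

definition min_separators :: "'a set \<Rightarrow> 'a set set \<Rightarrow> 'a set set" where
  "min_separators V E =
     (let Cs = some_perfect_ordering V E in clique_sep Cs ` {1..<length Cs} - {{}})"

definition sep_mult :: "'a set \<Rightarrow> 'a set set \<Rightarrow> 'a set \<Rightarrow> nat" where
  "sep_mult V E S =
     (let Cs = some_perfect_ordering V E in card {k \<in> {1..<length Cs}. clique_sep Cs k = S})"

section \<open>Moral directed acyclic graphs\<close>

text \<open>A pair \<open>(j, i) \<in> D\<close> is the directed edge from \<open>j\<close> to \<open>i\<close>.\<close>

definition parents :: "('a \<times> 'a) set \<Rightarrow> 'a \<Rightarrow> 'a set" where
  "parents D i = {j. (j, i) \<in> D}"

definition orientation :: "'a set set \<Rightarrow> ('a \<times> 'a) set \<Rightarrow> bool" where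
  "orientation E D \<longleftrightarrow> (\<forall>(i, j)\<in>D. {i, j} \<in> E) \<and>
     (\<forall>i j. {i, j} \<in> E \<longrightarrow> ((i, j) \<in> D \<longleftrightarrow> (j, i) \<notin> D))"

definition moral_dag :: "'a set set \<Rightarrow> ('a \<times> 'a) set \<Rightarrow> bool" where
  "moral_dag E D \<longleftrightarrow> orientation E D \<and> acyclic D \<and>
     (\<forall>i. \<forall>j\<in>parents D i. \<forall>k\<in>parents D i. j \<noteq> k \<longrightarrow> {j, k} \<in> E)"

section \<open>Graph polynomials and graph multinomial coefficients\<close>

text \<open>A multi-index $n \in \mathbb{N}^V$ is a finitely supported function \<open>n :: 'a \<Rightarrow>\<^sub>0 nat\<close> with
  \<open>keys n \<subseteq> V\<close>. Polynomials in the variables $x_i$ are finitely supported functions on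
  multi-indices, with the convolution product of \<open>Poly_Mapping\<close>; \<open>lookup p n\<close> is the coefficient
  of $x^n$ in \<open>p\<close>.\<close>

type_synonym 'a mpol = "('a \<Rightarrow>\<^sub>0 nat) \<Rightarrow>\<^sub>0 real"

definition var :: "'a \<Rightarrow> 'a mpol" where
  "var i = Poly_Mapping.single (Poly_Mapping.single i 1) 1"

definition Delta_poly :: "'a set \<Rightarrow> 'a set set \<Rightarrow> 'a mpol" where
  "Delta_poly V E = (\<Sum>C\<in>cliques V (complement_edges V E). (- 1) ^ card C * (\<Prod>i\<in>C. var i))"

definition delta_poly :: "'a set \<Rightarrow> 'a set set \<Rightarrow> 'a mpol" where
  "delta_poly V E = (\<Sum>C\<in>cliques V (complement_edges V E). \<Prod>i\<in>C. var i)"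

definition graph_multinomial :: "'a set \<Rightarrow> 'a set set \<Rightarrow> nat \<Rightarrow> ('a \<Rightarrow>\<^sub>0 nat) \<Rightarrow> real" where
  "graph_multinomial V E r n = Poly_Mapping.lookup (delta_poly V E ^ r) n"

text \<open>\<open>graph_neg_multinomial V E s n\<close> is the coefficient of $x^n$ in the formal power series
  $\Delta_G(x)^{-s} = \sum_k \binom{-s}{k} (\Delta_G(x) - 1)^k$. Since $\Delta_G - 1$ has no constant
  term, $(\Delta_G - 1)^k$ has no terms of degree less than \<open>k\<close>, so the series over \<open>k\<close> below has
  only finitely many nonzero terms.\<close>

definition graph_neg_multinomial :: "'a set \<Rightarrow> 'a set set \<Rightarrow> real \<Rightarrow> ('a \<Rightarrow>\<^sub>0 nat) \<Rightarrow> real" where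
  "graph_neg_multinomial V E s n =
     suminf (\<lambda>k. ((- s) gchoose k) * Poly_Mapping.lookup ((Delta_poly V E - 1) ^ k) n)"

section \<open>Ordinary coefficients\<close>

definition msum :: "('a \<Rightarrow>\<^sub>0 nat) \<Rightarrow> 'a set \<Rightarrow> nat" where
  "msum n A = (\<Sum>i\<in>A. Poly_Mapping.lookup n i)"

text \<open>This vanishes when \<open>msum n A > r\<close>. A quotient with such a factor in the denominator is to be
  read as 0, which is the HOL convention \<open>x / 0 = 0\<close>.\<close>

definition multinomial :: "nat \<Rightarrow> ('a \<Rightarrow>\<^sub>0 nat) \<Rightarrow> 'a set \<Rightarrow> real" where
  "multinomial r n A =
     (if msum n A \<le> r then fact r /
        (fact (r - msum n A) * (\<Prod>i\<in>A. fact (Poly_Mapping.lookup n i)))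
      else 0)"

text \<open>The coefficient written $\binom{|n_A| + s - 1}{n_A}$.\<close>

definition neg_multinomial :: "real \<Rightarrow> ('a \<Rightarrow>\<^sub>0 nat) \<Rightarrow> 'a set \<Rightarrow> real" where
  "neg_multinomial s n A =
     Gamma (real (msum n A) + s) / (Gamma s * (\<Prod>i\<in>A. fact (Poly_Mapping.lookup n i)))"

definition int_binomial :: "int \<Rightarrow> nat \<Rightarrow> nat" where
  "int_binomial a b = (if a < 0 then 0 else nat a choose b)"

text \<open>Only meant for $a > b - 1$.\<close>

definition real_binomial :: "real \<Rightarrow> nat \<Rightarrow> real" where
  "real_binomial a b = Gamma (a + 1) / (fact b * Gamma (a - real b + 1))"

end

theory Submission
  imports Defs
begin

text \<open>For a natural exponent \<open>r\<close>, the coefficient of \<open>y\<^sup>n\<close> in \<open>\<delta>\<^sub>G(y)\<^sup>r\<close> counts the ways to give each vertex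
  \<open>i\<close> a set of \<open>n\<^sub>i\<close> among \<open>r\<close> colours such that adjacent vertices get disjoint sets
  (\<open>graph_multinomial_counts_colourings\<close>). Suppose that a vertex \<open>v\<close> is added whose neighbours form a
  clique \<open>K\<close>. In every colouring the sets on \<open>K\<close> are disjoint and block exactly \<open>|n\<^sub>K|\<close> colours, so \<open>v\<close> has
  as many choices as there are \<open>n\<^sub>v\<close>-element subsets of an \<open>(r - |n\<^sub>K|)\<close>-element set. Thus the coefficient
  is multiplied by a factor that depends only on \<open>|n\<^sub>K|\<close> and \<open>n\<^sub>v\<close> (\<open>graph_multinomial_insert\<close>).

  For fixed \<open>n\<close>, the coefficient of \<open>y\<^sup>n\<close> in the formal power \<open>\<delta>\<^sub>G(y)\<^sup>t\<close> is a polynomial in \<open>t\<close>, and so is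
  the factor. The multiplication rule therefore passes from natural to real exponents
  (\<open>power_coeff_insert\<close>), and since \<open>\<Delta>\<^sub>G(x) = \<delta>\<^sub>G(- x)\<close>, the exponent \<open>t = - s\<close> gives the rule for the
  coefficients of \<open>\<Delta>\<^sub>G(x)\<^sup>-\<^sup>s\<close>.

  The rest uses only this rule (locale \<open>simplicial_product\<close>). Adding the vertices in a topological order
  of a moral DAG, where each vertex meets exactly its parents, yields the product over the vertices. In a
  perfect ordering each maximal clique \<open>C\<close> meets the union \<open>A\<close> of the earlier ones in the separator
  \<open>S = A \<inter> C\<close>, no edge joins \<open>A - C\<close> to \<open>C - A\<close>, and adding \<open>C - A\<close> vertex by vertex has the same effect on \<open>A\<close>
  as on \<open>S\<close>. Hence the value of \<open>A \<union> C\<close> times that of \<open>S\<close> is the value of \<open>A\<close> times that of \<open>C\<close>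
  (\<open>glue_clique\<close>), which yields the quotient over cliques and separators. The separators are read off
  from a chosen perfect ordering, so one has to exist: by Dirac's theorem a chordal graph has a vertex
  whose neighbours form a clique (\<open>simplicial_vertex_exists\<close>), and a perfect ordering is built up by
  adding such vertices (\<open>perfect_ordering_exists\<close>).\<close>

section \<open>Simplicial vertices of chordal graphs\<close>

definition clique :: "'a set set \<Rightarrow> 'a set \<Rightarrow> bool" where
  "clique E C \<longleftrightarrow> (\<forall>i\<in>C. \<forall>j\<in>C. i \<noteq> j \<longrightarrow> {i, j} \<in> E)"

definition nbrs :: "'a set set \<Rightarrow> 'a set \<Rightarrow> 'a \<Rightarrow> 'a set" where
  "nbrs E W v = {u \<in> W. {u, v} \<in> E}"

text \<open>An induced subgraph on \<open>W \<subseteq> V\<close> is represented by \<open>W\<close> and the full edge set \<open>E\<close>, whose edges may leave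
  \<open>W\<close>. So \<open>finite_simple_graph W E\<close> fails in general, and the absence of loops is assumed separately.\<close>

definition no_loops :: "'a set set \<Rightarrow> bool" where
  "no_loops E \<longleftrightarrow> (\<forall>i. {i} \<notin> E)"

lemma cliques_eq: "cliques W E = {C. C \<subseteq> W \<and> clique E C}"
  by (auto simp: cliques_def clique_def)

lemma clique_subset: "clique E C \<Longrightarrow> D \<subseteq> C \<Longrightarrow> clique E D"
  by (auto simp: clique_def)

lemma clique_insert: "clique E K \<Longrightarrow> K \<subseteq> nbrs E W v \<Longrightarrow> clique E (insert v K)"
  by (auto simp: clique_def nbrs_def insert_commute)

lemma decomposable_subset: "decomposable V E \<Longrightarrow> W \<subseteq> V \<Longrightarrow> decomposable W E"
  unfolding decomposable_def induced_cycle_def by blast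

text \<open>A shortest walk inside \<open>U\<close> has no chord, since a chord or a repeated vertex would shorten it.\<close>

lemma shortest_path_induced:
  assumes "(u, w) \<in> {(a, b). a \<in> U \<and> b \<in> U \<and> {a, b} \<in> E}\<^sup>*" and "no_loops E" and "u \<in> U"
  obtains f :: "nat \<Rightarrow> 'a" and n where "f 0 = u" "f n = w" "\<And>i. i \<le> n \<Longrightarrow> f i \<in> U"
    "inj_on f {..n}"
    "\<And>i j. i \<le> n \<Longrightarrow> j \<le> n \<Longrightarrow> {f i, f j} \<in> E \<longleftrightarrow> j = Suc i \<or> i = Suc j"
proof -
  define T where "T = {(a, b). a \<in> U \<and> b \<in> U \<and> {a, b} \<in> E}"
  define n where "n = (LEAST n. (u, w) \<in> T ^^ n)"
  from assms(1) have "\<exists>n. (u, w) \<in> T ^^ n"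
    unfolding T_def by (simp add: rtrancl_power)
  then have "(u, w) \<in> T ^^ n"
    unfolding n_def by (rule LeastI_ex)
  then obtain f where f: "f 0 = u" "f n = w" "\<And>i. i < n \<Longrightarrow> (f i, f (Suc i)) \<in> T"
    by (auto simp: relpow_fun_conv)
  have minimal: "n \<le> m" if "(u, w) \<in> T ^^ m" for m
    unfolding n_def using that by (rule Least_le)
  have fU: "f i \<in> U" if "i \<le> n" for i
    using f(1) f(3)[of "i - 1"] that assms(3) by (cases i) (auto simp: T_def)
  have prefix: "(u, f i) \<in> T ^^ i" if "i \<le> n" for i
    using that f by (auto simp: relpow_fun_conv intro!: exI[of _ f])
  have suffix: "(f j, w) \<in> T ^^ (n - j)" if "j \<le> n" for j
    using that f by (auto simp: relpow_fun_conv intro!: exI[of _ "\<lambda>i. f (j + i)"])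
  have distinct: "f i \<noteq> f j" if "i < j" "j \<le> n" for i j
  proof
    assume "f i = f j"
    with prefix[of i] suffix[of j] that have "(u, w) \<in> T ^^ (i + (n - j))"
      unfolding relpow_add by auto
    with minimal that show False by fastforce
  qed
  have chordless: "{f i, f j} \<notin> E" if "Suc i < j" "j \<le> n" for i j
  proof
    assume "{f i, f j} \<in> E"
    with fU that have "(f i, f j) \<in> T" by (auto simp: T_def)
    with prefix[of i] suffix[of j] that have "(u, w) \<in> T ^^ (Suc i + (n - j))"
      by (auto simp only: relpow_add relpow.simps intro!: relcompI)
    with minimal that show False by fastforce
  qed
  have step: "{f i, f (Suc i)} \<in> E" if "i < n" for i
    using f(3)[OF that] by (auto simp: T_def)
  have adj: "{f i, f j} \<in> E \<longleftrightarrow> j = Suc i" if "i < j" "j \<le> n" for i j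
    using chordless[of i j] step[of i] that by (cases "j = Suc i") auto
  show thesis
  proof (rule that[of f n])
    show "inj_on f {..n}"
      using distinct by (auto simp: inj_on_def) (metis linorder_neqE_nat)
    show "{f i, f j} \<in> E \<longleftrightarrow> j = Suc i \<or> i = Suc j" if "i \<le> n" "j \<le> n" for i j
      using adj[of i j] adj[of j i] that assms(2)
      by (cases i j rule: linorder_cases) (auto simp: no_loops_def insert_commute)
  qed (use f fU in auto)
qed

text \<open>If two neighbours \<open>u\<close> and \<open>w\<close> of \<open>x\<close> were not adjacent, a shortest path between them whose
  inner vertices are not adjacent to \<open>x\<close> would close up with \<open>x\<close> to an induced cycle of length at
  least 4.\<close>

lemma common_neighbours_adjacent:
  assumes dec: "decomposable W E" and lf: "no_loops E" and x: "x \<in> W"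
    and B: "B \<subseteq> W" "x \<notin> B" "B \<inter> nbrs E W x = {}"
    and u: "u \<in> nbrs E W x" "u \<noteq> w" and w: "w \<in> nbrs E W x"
    and conn: "(u, w) \<in> {(a, b). a \<in> insert u (insert w B) \<and> b \<in> insert u (insert w B) \<and> {a, b} \<in> E}\<^sup>*"
  shows "{u, w} \<in> E"
proof (rule ccontr)
  assume nonadj: "{u, w} \<notin> E"
  obtain f n where f: "f 0 = u" "f n = w" and fU: "\<And>i. i \<le> n \<Longrightarrow> f i \<in> insert u (insert w B)"
    and inj: "inj_on f {..n}"
    and adj: "\<And>i j. i \<le> n \<Longrightarrow> j \<le> n \<Longrightarrow> {f i, f j} \<in> E \<longleftrightarrow> j = Suc i \<or> i = Suc j"
    by (rule shortest_path_induced[OF conn lf]) auto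
  have xu: "x \<noteq> u" "x \<noteq> w"
    using u w lf by (auto simp: nbrs_def no_loops_def)
  have n: "n \<ge> 2"
    using f u(2) nonadj adj[of 0 n] by (cases n rule: nat.exhaust) (auto simp: Suc_le_eq)
  have fx: "f i \<noteq> x" if "i \<le> n" for i
    using fU[OF that] B(2) xu by auto
  have xadj: "{x, f i} \<in> E \<longleftrightarrow> i = 0 \<or> i = n" if "i \<le> n" for i
  proof (cases "i = 0 \<or> i = n")
    case True
    then show ?thesis using f u w by (auto simp: nbrs_def insert_commute)
  next
    case False
    then have "f i \<noteq> u" "f i \<noteq> w"
      using f inj that by (auto simp: inj_on_def)
    with fU[OF that] have "f i \<in> B" by auto
    with B False show ?thesis by (auto simp: nbrs_def insert_commute)
  qed
  \<comment> \<open>The induced cycle runs through the path and returns to its start via \<open>x\<close>.\<close>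
  define g where "g i = (if i \<le> n then f i else x)" for i
  define p where "p = map g [0..<n + 2]"
  have "inj_on g {0..<n + 2}"
    using inj fx by (auto simp: inj_on_def g_def)
  then have "distinct p" unfolding p_def distinct_map set_upt by simp
  moreover have "f i \<in> W" if "i \<le> n" for i
    using fU[OF that] B(1) u w by (auto simp: nbrs_def)
  then have "set p \<subseteq> W"
    using x by (auto simp: p_def g_def)
  moreover have "{g i, g j} \<in> E \<longleftrightarrow> j = Suc i mod (n + 2) \<or> i = Suc j mod (n + 2)"
    if ij: "i < n + 2" "j < n + 2" for i j
  proof -
    have sucmod: "Suc i mod (n + 2) = (if i \<le> n then Suc i else 0)" if "i < n + 2" for i
      using that by (auto simp: mod_Suc)
    consider "i \<le> n" "j \<le> n" | "i = n + 1" "j \<le> n" | "i \<le> n" "j = n + 1" | "i = n + 1" "j = n + 1"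
      using ij by linarith
    then show ?thesis
      unfolding sucmod[OF ij(1)] sucmod[OF ij(2)]
    proof cases
      case 1
      then show "({g i, g j} \<in> E) = (j = (if i \<le> n then Suc i else 0) \<or> i = (if j \<le> n then Suc j else 0))"
        using adj[of i j] by (simp add: g_def)
    next
      case 2
      then show "({g i, g j} \<in> E) = (j = (if i \<le> n then Suc i else 0) \<or> i = (if j \<le> n then Suc j else 0))"
        using xadj[of j] by (auto simp: g_def)
    next
      case 3
      then show "({g i, g j} \<in> E) = (j = (if i \<le> n then Suc i else 0) \<or> i = (if j \<le> n then Suc j else 0))"
        using xadj[of i] by (auto simp: g_def insert_commute)
    next
      case 4
      then show "({g i, g j} \<in> E) = (j = (if i \<le> n then Suc i else 0) \<or> i = (if j \<le> n then Suc j else 0))"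
        using lf by (auto simp: g_def no_loops_def)
    qed
  qed
  ultimately have "induced_cycle W E p"
    by (simp add: induced_cycle_def p_def del: upt_Suc)
  moreover have "length p > 3" using n by (simp add: p_def)
  ultimately show False using dec by (auto simp: decomposable_def)
qed

text \<open>A one-sided form of Dirac's theorem that can be proved by induction. Let \<open>B\<close> be a component of the
  vertices that are neither \<open>x\<close> nor adjacent to it, and let \<open>S\<close> be the set of vertices outside \<open>B\<close>
  with a neighbour in \<open>B\<close>. All of \<open>S\<close> is adjacent to \<open>x\<close>, so \<open>S\<close> is a clique by the previous
  lemma. The graph induced on \<open>B \<union> S\<close> omits \<open>x\<close>, and a simplicial vertex of it that lies in \<open>B\<close> is
  simplicial in the whole graph. If a vertex of \<open>S\<close> has a non-neighbour in \<open>B\<close>, the induction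
  hypothesis is applied to that vertex of \<open>S\<close>. Otherwise \<open>S\<close> is joined completely to \<open>B\<close>, and the
  hypothesis is applied to a vertex of \<open>B\<close> with a non-neighbour in \<open>B\<close>. In both cases the simplicial
  vertex obtained cannot lie in \<open>S\<close>. If there is no such vertex either, \<open>B \<union> S\<close> is a clique.\<close>

lemma simplicial_vertex_avoiding:
  assumes "finite W" and "decomposable W E" and lf: "no_loops E"
    and "x \<in> W" and "y \<in> W" and "y \<noteq> x" and "y \<notin> nbrs E W x"
  shows "\<exists>v\<in>W. v \<noteq> x \<and> v \<notin> nbrs E W x \<and> clique E (nbrs E W v)"
  using assms(1,2,4-)
proof (induction "card W" arbitrary: W x y rule: less_induct)
  case less
  define Z where "Z = W - insert x (nbrs E W x)"
  define R where "R = {(a, b). a \<in> Z \<and> b \<in> Z \<and> {a, b} \<in> E}"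
  define B where "B = {z. (y, z) \<in> R\<^sup>*}"
  define S where "S = {u \<in> W - B. \<exists>b\<in>B. {u, b} \<in> E}"
  have yZ: "y \<in> Z" using less.prems by (auto simp: Z_def)
  have BZ: "B \<subseteq> Z"
  proof
    fix z assume "z \<in> B"
    then have "(y, z) \<in> R\<^sup>*" by (simp add: B_def)
    then show "z \<in> Z" by (induction) (use yZ in \<open>auto simp: R_def\<close>)
  qed
  have yB: "y \<in> B" by (simp add: B_def)
  have closed: "c \<in> B" if "b \<in> B" "c \<in> Z" "{b, c} \<in> E" for b c
    using that BZ by (auto simp: B_def R_def intro: rtrancl.rtrancl_into_rtrancl)
  have SN: "S \<subseteq> nbrs E W x"
  proof
    fix u assume "u \<in> S"
    then obtain b where b: "b \<in> B" "{b, u} \<in> E" "u \<in> W" "u \<notin> B"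
      by (auto simp: S_def insert_commute)
    then have "u \<notin> Z" using closed by blast
    moreover have "u \<noteq> x"
      using b BZ by (auto simp: Z_def nbrs_def)
    ultimately show "u \<in> nbrs E W x" using b by (auto simp: Z_def)
  qed
  have symR: "sym R" by (auto simp: R_def sym_def insert_commute)
  have S_clique: "clique E S"
    unfolding clique_def
  proof (intro ballI impI)
    fix u w assume uw: "u \<in> S" "w \<in> S" "u \<noteq> w"
    define U where "U = insert u (insert w B)"
    define T where "T = {(a, b). a \<in> U \<and> b \<in> U \<and> {a, b} \<in> E}"
    obtain a b where ab: "a \<in> B" "{u, a} \<in> E" "b \<in> B" "{w, b} \<in> E"
      using uw by (auto simp: S_def)
    have reach: "(a, c) \<in> T\<^sup>*" if "(a, c) \<in> R\<^sup>*" for c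
      using that
    proof induction
      case (step c d)
      have "(y, c) \<in> R\<^sup>*" using ab(1) step(1) by (auto simp: B_def)
      with step(2) have "c \<in> B" "d \<in> B" by (auto simp: B_def intro: rtrancl.rtrancl_into_rtrancl)
      with step(2) have "(c, d) \<in> T" by (auto simp: T_def U_def R_def)
      with step(3) show ?case by (rule rtrancl.rtrancl_into_rtrancl)
    qed simp
    have "(a, y) \<in> R\<^sup>*"
      using ab(1) sym_rtrancl[OF symR] by (auto simp: B_def dest: symD)
    then have "(a, b) \<in> R\<^sup>*" using ab(3) by (auto simp: B_def)
    then have "(a, b) \<in> T\<^sup>*" by (rule reach)
    moreover have "(u, a) \<in> T" "(b, w) \<in> T"
      using ab by (auto simp: T_def U_def insert_commute)
    ultimately have "(u, w) \<in> T\<^sup>*"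
      by (meson converse_rtrancl_into_rtrancl rtrancl.rtrancl_into_rtrancl)
    then show "{u, w} \<in> E"
      unfolding T_def U_def
      using common_neighbours_adjacent[OF less.prems(2) lf less.prems(3), of B u w] uw SN BZ
      by (auto simp: Z_def)
  qed
  define H where "H = B \<union> S"
  have HW: "H \<subseteq> W" "x \<notin> H"
    using BZ SN lf by (auto simp: H_def Z_def S_def nbrs_def no_loops_def)
  then have smaller: "card H < card W"
    using less.prems by (metis psubsetI psubset_card_mono)
  have nbrs_H: "nbrs E H v = nbrs E W v" if "v \<in> B" for v
    using that HW by (auto simp: nbrs_def H_def S_def)
  have finish: ?case if "v \<in> B" "clique E (nbrs E H v)" for v
    using that nbrs_H[OF that(1)] BZ by (auto simp: Z_def)
  have IH: "\<exists>v\<in>H. v \<noteq> a \<and> v \<notin> nbrs E H a \<and> clique E (nbrs E H v)"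
    if "a \<in> H" "b \<in> H" "b \<noteq> a" "b \<notin> nbrs E H a" for a b
    using less.hyps[OF smaller _ _ that] finite_subset[OF HW(1)] decomposable_subset[OF _ HW(1)]
      less.prems(1,2) by blast
  consider (S) a b where "a \<in> S" "b \<in> B" "{b, a} \<notin> E"
    | (B) a b where "\<And>s b. s \<in> S \<Longrightarrow> b \<in> B \<Longrightarrow> {b, s} \<in> E" "a \<in> B" "b \<in> B" "b \<noteq> a" "{b, a} \<notin> E"
    | (complete) "\<And>s b. s \<in> S \<Longrightarrow> b \<in> B \<Longrightarrow> {b, s} \<in> E" "clique E B"
    unfolding clique_def by (metis)
  then show ?case
  proof cases
    case S
    then have "a \<in> H" "b \<in> H" "b \<noteq> a" "b \<notin> nbrs E H a"
      by (auto simp: H_def S_def nbrs_def)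
    from IH[OF this] obtain v where v: "v \<in> H" "v \<noteq> a" "v \<notin> nbrs E H a" "clique E (nbrs E H v)"
      by blast
    then have "v \<notin> S" using S(1) S_clique by (auto simp: clique_def nbrs_def)
    with v finish show ?thesis by (auto simp: H_def)
  next
    case B
    then have "a \<in> H" "b \<in> H" "b \<noteq> a" "b \<notin> nbrs E H a"
      by (auto simp: H_def nbrs_def)
    from IH[OF this] obtain v where v: "v \<in> H" "v \<noteq> a" "v \<notin> nbrs E H a" "clique E (nbrs E H v)"
      by blast
    then have "v \<notin> S" using B(1)[of v a] B(2) by (auto simp: nbrs_def insert_commute)
    with v finish show ?thesis by (auto simp: H_def)
  next
    case complete
    then have "clique E H"
      using S_clique unfolding clique_def H_def by (metis UnE insert_commute)
    then have "clique E (nbrs E H y)"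
      by (rule clique_subset) (auto simp: nbrs_def)
    with yB finish show ?thesis by blast
  qed
qed

lemma simplicial_vertex_exists:
  assumes "finite W" and "decomposable W E" and "no_loops E" and "W \<noteq> {}"
  obtains v where "v \<in> W" "clique E (nbrs E W v)"
proof (cases "clique E W")
  case True
  with assms(4) show thesis using that clique_subset[of E W] by (auto simp: nbrs_def)
next
  case False
  then obtain x y where "x \<in> W" "y \<in> W" "y \<noteq> x" "y \<notin> nbrs E W x"
    by (auto simp: clique_def nbrs_def insert_commute)
  from simplicial_vertex_avoiding[OF assms(1-3) this] show thesis using that by blast
qed

section \<open>Perfect orderings of the maximal cliques\<close>

lemma max_cliquesI:
  "C \<in> cliques W E \<Longrightarrow> (\<And>D. D \<in> cliques W E \<Longrightarrow> C \<subseteq> D \<Longrightarrow> D = C) \<Longrightarrow> C \<in> max_cliques W E"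
  by (simp add: max_cliques_def)

lemma finite_clique_extends_to_max_clique:
  assumes "finite W" and "K \<in> cliques W E"
  obtains D where "D \<in> max_cliques W E" "K \<subseteq> D"
proof -
  have "finite (cliques W E)"
    using assms(1) by (auto simp: cliques_def)
  from finite_has_maximal2[OF this assms(2)] show thesis
    using that by (auto simp: max_cliques_def)
qed

text \<open>A simplicial vertex lies in exactly one maximal clique, formed by it and its neighbours. Removing it
  affects only this clique; the set of neighbours may or may not be maximal afterwards.\<close>

lemma max_cliques_remove_simplicial:
  assumes lf: "no_loops E" and v: "v \<in> W" and K: "clique E (nbrs E W v)"
  shows "max_cliques W E =
    insert (insert v (nbrs E W v)) (max_cliques (W - {v}) E - {nbrs E W v})"
proof -
  let ?K = "nbrs E W v" and ?C = "insert v (nbrs E W v)"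
  have vK: "v \<notin> ?K" using lf by (auto simp: nbrs_def no_loops_def)
  have KW: "?K \<subseteq> W - {v}" using vK by (auto simp: nbrs_def)
  have K_clique: "?K \<in> cliques (W - {v}) E" using K KW by (simp add: cliques_eq)
  have C_clique: "?C \<in> cliques W E"
    using clique_insert[OF K order_refl] KW v by (auto simp: cliques_eq)
  have with_v: "D \<subseteq> ?C" if "D \<in> cliques W E" "v \<in> D" for D
    using that by (auto simp: cliques_def nbrs_def)
  have without_v: "D \<in> cliques (W - {v}) E \<longleftrightarrow> D \<in> cliques W E \<and> v \<notin> D" for D
    by (auto simp: cliques_def)
  show ?thesis
  proof (intro equalityI subsetI)
    fix D assume "D \<in> max_cliques W E"
    then have D: "D \<in> cliques W E" and max: "\<And>D'. D' \<in> cliques W E \<Longrightarrow> D \<subseteq> D' \<Longrightarrow> D' = D"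
      by (auto simp: max_cliques_def)
    show "D \<in> insert ?C (max_cliques (W - {v}) E - {?K})"
    proof (cases "v \<in> D")
      case True
      then have "?C = D" using with_v[OF D True] max[OF C_clique] by simp
      then show ?thesis by simp
    next
      case False
      then have "D \<noteq> ?K" using max[OF C_clique] by blast
      moreover have "D \<in> max_cliques (W - {v}) E"
      proof (rule max_cliquesI)
        show "D' = D" if "D' \<in> cliques (W - {v}) E" "D \<subseteq> D'" for D'
          using max[OF _ that(2)] that(1) without_v by blast
      qed (use False D without_v in blast)
      ultimately show ?thesis by simp
    qed
  next
    fix D assume D: "D \<in> insert ?C (max_cliques (W - {v}) E - {?K})"
    show "D \<in> max_cliques W E"
    proof (cases "D = ?C")
      case True
      show ?thesis
        unfolding True
      proof (rule max_cliquesI[OF C_clique])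
        show "D' = ?C" if "D' \<in> cliques W E" "?C \<subseteq> D'" for D'
          using with_v[OF that(1)] that(2) by blast
      qed
    next
      case False
      with D have D: "D \<in> cliques (W - {v}) E" "D \<noteq> ?K"
        and max: "\<And>D'. D' \<in> cliques (W - {v}) E \<Longrightarrow> D \<subseteq> D' \<Longrightarrow> D' = D"
        by (auto simp: max_cliques_def)
      have max_W: "D' = D" if D': "D' \<in> cliques W E" "D \<subseteq> D'" for D'
      proof (cases "v \<in> D'")
        case True
        with D' D with_v[of D'] have "D \<subseteq> ?K" by (auto simp: without_v)
        from max[OF K_clique this] D(2) show ?thesis by simp
      next
        case False
        with D' have "D' \<in> cliques (W - {v}) E" by (simp add: without_v)
        from max[OF this D'(2)] show ?thesis .
      qed
      from max_cliquesI[OF _ this] D(1) without_v show ?thesis by blast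
    qed
  qed
qed

text \<open>By induction, a simplicial vertex \<open>v\<close> with neighbourhood \<open>K\<close> is added to a graph with a perfect
  ordering. If \<open>K\<close> was a maximal clique, it is enlarged by \<open>v\<close> where it stands; this changes no separator,
  because \<open>v\<close> lies in no other clique. Otherwise the new clique is put at the end, and its separator \<open>K\<close>
  is contained in an earlier maximal clique.\<close>

lemma perfect_ordering_exists:
  assumes "finite W" and "decomposable W E" and lf: "no_loops E"
  shows "\<exists>Cs. perfect_ordering W E Cs"
  using assms(1,2)
proof (induction "card W" arbitrary: W rule: less_induct)
  case less
  show ?case
  proof (cases "W = {}")
    case True
    then have "perfect_ordering W E [{}]"
      by (auto simp: perfect_ordering_def max_cliques_def cliques_def)
    then show ?thesis ..
  next
    case False
    then obtain v where v: "v \<in> W" and K_clique: "clique E (nbrs E W v)"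
      using simplicial_vertex_exists[OF less.prems lf] by blast
    define K where "K = nbrs E W v"
    define C where "C = insert v K"
    define H where "H = W - {v}"
    have "card H < card W" using less.prems(1) v unfolding H_def by (rule card_Diff1_less)
    from less.hyps[OF this] obtain Cs where Cs: "perfect_ordering H E Cs"
      using less.prems decomposable_subset[of W E H] by (auto simp: H_def)
    have dist: "distinct Cs" and set_Cs: "set Cs = max_cliques H E"
      and sep: "\<And>k. 1 \<le> k \<Longrightarrow> k < length Cs \<Longrightarrow> \<exists>l<k. clique_sep Cs k \<subseteq> Cs ! l"
      using Cs by (auto simp: perfect_ordering_def)
    have max_W: "max_cliques W E = insert C (max_cliques H E - {K})"
      using max_cliques_remove_simplicial[OF lf v K_clique] by (simp add: C_def K_def H_def)
    have KH: "K \<in> cliques H E"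
      using K_clique lf by (auto simp: cliques_eq K_def H_def nbrs_def no_loops_def)
    have no_v: "v \<notin> D" if "D \<in> set Cs" for D
      using that by (auto simp: set_Cs max_cliques_def cliques_def H_def)
    then have C_new: "C \<notin> set Cs" by (auto simp: C_def)
    show ?thesis
    proof (cases "K \<in> set Cs")
      case True
      define Ds where "Ds = map (\<lambda>D. if D = K then C else D) Cs"
      have nth: "Ds ! l = (if Cs ! l = K then C else Cs ! l)" if "l < length Cs" for l
        using that by (simp add: Ds_def)
      have "distinct Ds"
        using dist C_new by (auto simp: Ds_def distinct_map inj_on_def)
      moreover have "set Ds = max_cliques W E"
        using True by (auto simp: Ds_def max_W simp flip: set_Cs)
      moreover have "\<exists>l<k. clique_sep Ds k \<subseteq> Ds ! l" if k: "1 \<le> k" "k < length Ds" for k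
      proof -
        have k': "k < length Cs" using k by (simp add: Ds_def)
        have "clique_sep Ds k \<subseteq> clique_sep Cs k"
        proof
          fix x assume "x \<in> clique_sep Ds k"
          then obtain l where l: "l < k" "x \<in> Ds ! k" "x \<in> Ds ! l" by (auto simp: clique_sep_def)
          moreover have "Cs ! l \<noteq> Cs ! k" using l k' dist by (simp add: nth_eq_iff_index_eq)
          moreover have "v \<notin> Cs ! l" "v \<notin> Cs ! k" using no_v l k' by auto
          ultimately have "x \<in> Cs ! k" "x \<in> Cs ! l"
            using nth[of k] nth[of l] k' by (auto simp: C_def split: if_splits)
          with l show "x \<in> clique_sep Cs k" by (auto simp: clique_sep_def)
        qed
        moreover obtain l where "l < k" "clique_sep Cs k \<subseteq> Cs ! l" using sep k' k by blast
        moreover have "Cs ! l \<subseteq> Ds ! l" if "l < k" for l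
          using nth[of l] that k' by (auto simp: C_def)
        ultimately show ?thesis by blast
      qed
      ultimately have "perfect_ordering W E Ds" by (auto simp: perfect_ordering_def)
      then show ?thesis ..
    next
      case False
      define Ds where "Ds = Cs @ [C]"
      have sep_old: "clique_sep Ds k = clique_sep Cs k" if "k < length Cs" for k
        using that by (auto simp: clique_sep_def Ds_def nth_append)
      have "distinct Ds" using dist C_new by (simp add: Ds_def)
      moreover have "set Ds = max_cliques W E"
        using False by (auto simp: Ds_def max_W simp flip: set_Cs)
      moreover have "\<exists>l<k. clique_sep Ds k \<subseteq> Ds ! l" if k: "1 \<le> k" "k < length Ds" for k
      proof (cases "k < length Cs")
        case True
        with sep k obtain l where "l < k" "clique_sep Cs k \<subseteq> Cs ! l" by blast
        with True sep_old show ?thesis by (auto simp: Ds_def nth_append)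
      next
        case False
        with k have k_eq: "k = length Cs" by (simp add: Ds_def)
        have "finite H" using less.prems(1) by (simp add: H_def)
        from finite_clique_extends_to_max_clique[OF this KH]
        obtain D where "D \<in> max_cliques H E" "K \<subseteq> D" by blast
        then obtain l where l: "l < length Cs" "K \<subseteq> Cs ! l"
          by (metis in_set_conv_nth set_Cs)
        have "clique_sep Ds k \<subseteq> K"
          using no_v by (auto simp: clique_sep_def k_eq Ds_def nth_append C_def)
        with l show ?thesis by (auto simp: k_eq Ds_def nth_append)
      qed
      ultimately have "perfect_ordering W E Ds" by (auto simp: perfect_ordering_def)
      then show ?thesis ..
    qed
  qed
qed

text \<open>Consider the first clique that contains such an edge. If it came after position \<open>k\<close>, both ends would lie
  in its separator and hence in an earlier clique.\<close>

lemma no_edge_across_clique_sep: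
  assumes po: "perfect_ordering V E Cs" and fin: "finite V" and EV: "\<And>u w. {u, w} \<in> E \<Longrightarrow> u \<in> V \<and> w \<in> V"
    and k: "k < length Cs" and u: "u \<in> Cs ! k" "u \<notin> (\<Union>l<k. Cs ! l)"
    and w: "w \<in> (\<Union>l<k. Cs ! l)" "w \<notin> Cs ! k"
  shows "{u, w} \<notin> E"
proof
  assume uw: "{u, w} \<in> E"
  define P where "P m \<longleftrightarrow> m < length Cs \<and> u \<in> Cs ! m \<and> w \<in> Cs ! m" for m
  have "{u, w} \<in> cliques V E"
    using uw EV[OF uw] by (auto simp: cliques_def insert_commute)
  from finite_clique_extends_to_max_clique[OF fin this]
  obtain D where "D \<in> max_cliques V E" "{u, w} \<subseteq> D" .
  then have "D \<in> set Cs" "u \<in> D" "w \<in> D"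
    using po by (auto simp: perfect_ordering_def)
  then have "\<exists>m. P m" by (auto simp: P_def in_set_conv_nth)
  define m where "m = (LEAST m. P m)"
  have m: "P m" unfolding m_def using \<open>\<exists>m. P m\<close> by (rule LeastI_ex)
  have least: "\<not> P l" if "l < m" for l
    using that unfolding m_def by (rule not_less_Least)
  have "\<not> m < k" "m \<noteq> k"
    using m u w by (auto simp: P_def)
  then have "k < m" by simp
  then have "m \<in> {1..<length Cs}" using m by (simp add: P_def)
  then obtain l where l: "l < m" "clique_sep Cs m \<subseteq> Cs ! l"
    using po unfolding perfect_ordering_def by blast
  have "u \<in> clique_sep Cs m" "w \<in> clique_sep Cs m"
    using m u w \<open>k < m\<close> by (auto simp: clique_sep_def P_def)
  with l m have "P l" by (auto simp: P_def)
  with least l show False by blast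
qed

lemma Union_perfect_ordering:
  assumes "perfect_ordering V E Cs" and "finite V"
  shows "(\<Union>l<length Cs. Cs ! l) = V"
proof -
  have "\<Union> (max_cliques V E) = V"
  proof (intro equalityI subsetI)
    fix x assume "x \<in> V"
    then have "{x} \<in> cliques V E" by (auto simp: cliques_def)
    from finite_clique_extends_to_max_clique[OF assms(2) this] show "x \<in> \<Union> (max_cliques V E)"
      by blast
  qed (auto simp: max_cliques_def cliques_def)
  moreover have "(\<Union>l<length Cs. Cs ! l) = \<Union> (set Cs)"
    by (auto simp: set_conv_nth)
  ultimately show ?thesis using assms(1) by (simp add: perfect_ordering_def)
qed

section \<open>Product formulas from attaching vertices to cliques\<close>

text \<open>The two kinds of coefficients, as functions \<open>g\<close> of the vertex set, share one property: attaching a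
  vertex to a clique multiplies \<open>g\<close> by a factor \<open>\<phi> p m\<close> that depends only on the total weight \<open>p\<close> of the
  clique and on the weight \<open>m\<close> of the vertex. All product formulas follow from it.\<close>

locale simplicial_product =
  fixes V :: "'a set" and E :: "'a set set" and n :: "'a \<Rightarrow>\<^sub>0 nat"
    and \<phi> :: "nat \<Rightarrow> nat \<Rightarrow> real" and g :: "'a set \<Rightarrow> real"
  assumes finite_V: "finite V"
    and edges: "\<And>e. e \<in> E \<Longrightarrow> e \<subseteq> V \<and> card e = 2"
    and empty: "g {} = 1"
    and extend: "\<And>v W. W \<subseteq> V \<Longrightarrow> v \<in> V - W \<Longrightarrow> clique E (nbrs E W v) \<Longrightarrow>
      g (insert v W) = g W * \<phi> (msum n (nbrs E W v)) (Poly_Mapping.lookup n v)"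
begin

lemma no_loops_E: "no_loops E"
  using edges by (force simp: no_loops_def)

text \<open>A sink of the graph induced on a set closed under parents has its parents as neighbours there, and
  these form a clique by morality. So sinks can be removed one after the other.\<close>

lemma moral_dag_product_ancestral:
  assumes D: "moral_dag E D" and "W \<subseteq> V" and "\<And>i. i \<in> W \<Longrightarrow> parents D i \<subseteq> W"
  shows "g W = (\<Prod>i\<in>W. \<phi> (msum n (parents D i)) (Poly_Mapping.lookup n i))"
  using assms(2-)
proof (induction "card W" arbitrary: W rule: less_induct)
  case less
  have finW: "finite W" using less.prems finite_V finite_subset by blast
  show ?case
  proof (cases "W = {}")
    case True
    then show ?thesis by (simp add: empty)
  next
    case False
    have DE: "{i, j} \<in> E" if "(i, j) \<in> D" for i j
      using D that by (auto simp: moral_dag_def orientation_def)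
    then have "D \<subseteq> V \<times> V" using edges by fastforce
    then have "finite D" using finite_V by (meson finite_SigmaI finite_subset)
    then have "wf (D\<inverse>)"
      using D by (simp add: moral_dag_def finite_acyclic_wf_converse)
    with False obtain v where v: "v \<in> W" and sink: "\<And>u. (v, u) \<in> D \<Longrightarrow> u \<notin> W"
      by (metis converse_iff ex_in_conv wfE_min)
    have no_loop: "(v, v) \<notin> D" using DE[of v v] no_loops_E by (auto simp: no_loops_def)
    have pa: "nbrs E (W - {v}) v = parents D v"
    proof (intro equalityI subsetI)
      fix u assume "u \<in> nbrs E (W - {v}) v"
      then have "{v, u} \<in> E" "u \<in> W" by (auto simp: nbrs_def insert_commute)
      then show "u \<in> parents D v"
        using D sink by (auto simp: moral_dag_def orientation_def parents_def)
    next
      fix u assume "u \<in> parents D v"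
      then show "u \<in> nbrs E (W - {v}) v"
        using less.prems(2)[OF v] DE[of u v] no_loop by (auto simp: nbrs_def parents_def)
    qed
    have "g (W - {v}) = (\<Prod>i\<in>W - {v}. \<phi> (msum n (parents D i)) (Poly_Mapping.lookup n i))"
    proof (rule less.hyps)
      show "card (W - {v}) < card W" using finW v by (rule card_Diff1_less)
      show "W - {v} \<subseteq> V" using less.prems by auto
      show "parents D i \<subseteq> W - {v}" if "i \<in> W - {v}" for i
        using less.prems(2)[of i] that sink by (auto simp: parents_def)
    qed
    moreover have "g W = g (W - {v}) * \<phi> (msum n (parents D v)) (Poly_Mapping.lookup n v)"
      using extend[of "W - {v}" v] v less.prems(1) D pa
      by (auto simp: insert_absorb moral_dag_def clique_def)
    ultimately show ?thesis
      by (simp add: prod.remove[OF finW v] mult.commute)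
  qed
qed

lemma moral_dag_product:
  assumes D: "moral_dag E D"
  shows "g V = (\<Prod>i\<in>V. \<phi> (msum n (parents D i)) (Poly_Mapping.lookup n i))"
proof (rule moral_dag_product_ancestral[OF D order_refl])
  show "parents D i \<subseteq> V" for i
    using D edges by (fastforce simp: moral_dag_def orientation_def parents_def)
qed

text \<open>With the other formulas this turns values of \<open>g\<close> on cliques and separators into the explicit coefficients \<open>h\<close>,
  which obey the same rule when a clique grows by a vertex.\<close>

lemma clique_value:
  assumes "C \<subseteq> V" and "clique E C" and "h {} = 1"
    and "\<And>v K. v \<notin> K \<Longrightarrow> finite K \<Longrightarrow> h (insert v K) = h K * \<phi> (msum n K) (Poly_Mapping.lookup n v)"
  shows "g C = h C"
proof -
  have "finite C" using assms(1) finite_V finite_subset by blast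
  then show ?thesis
    using assms(1,2)
  proof (induction C)
    case (insert v K)
    have "nbrs E K v = K" using insert by (auto simp: nbrs_def clique_def)
    then show ?case
      using insert extend[of K v] assms(4)[of v K] clique_subset[OF insert.prems(2), of K] by auto
  qed (use assms(3) empty in simp)
qed

text \<open>The vertices of \<open>C - A\<close> are attached one by one, both to \<open>A\<close> and to \<open>A \<inter> C\<close>. Each of them has the same
  neighbours in both cases, so both sides are multiplied by the same factors.\<close>

lemma glue_clique:
  assumes "A \<subseteq> V" and "C \<subseteq> V" and "clique E C"
    and sep: "\<And>u w. u \<in> C - A \<Longrightarrow> w \<in> A - C \<Longrightarrow> {u, w} \<notin> E"
  shows "g (A \<union> C) * g (A \<inter> C) = g A * g C"
proof -
  have "g (A \<union> R) * g (A \<inter> C) = g A * g (A \<inter> C \<union> R)" if "finite R" "R \<subseteq> C - A" for R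
    using that
  proof (induction R)
    case (insert v R)
    have n1: "nbrs E (A \<union> R) v = A \<inter> C \<union> R"
    proof (intro equalityI subsetI)
      fix u assume "u \<in> nbrs E (A \<union> R) v"
      then have "u \<in> A \<union> R" "{v, u} \<in> E" by (auto simp: nbrs_def insert_commute)
      then show "u \<in> A \<inter> C \<union> R" using sep[of v u] insert.prems by auto
    next
      fix u assume u: "u \<in> A \<inter> C \<union> R"
      then have "u \<in> C" "v \<in> C" "u \<noteq> v" using insert.prems insert.hyps by auto
      with u assms(3) show "u \<in> nbrs E (A \<union> R) v" by (auto simp: nbrs_def clique_def)
    qed
    have n2: "nbrs E (A \<inter> C \<union> R) v = A \<inter> C \<union> R"
    proof (intro equalityI subsetI)
      fix u assume u: "u \<in> A \<inter> C \<union> R"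
      then have "u \<in> C" "v \<in> C" "u \<noteq> v" using insert.prems insert.hyps by auto
      with u assms(3) show "u \<in> nbrs E (A \<inter> C \<union> R) v" by (auto simp: nbrs_def clique_def)
    qed (simp add: nbrs_def)
    have cl: "clique E (A \<inter> C \<union> R)"
      using insert.prems by (intro clique_subset[OF assms(3)]) auto
    have "g (insert v (A \<union> R)) =
        g (A \<union> R) * \<phi> (msum n (A \<inter> C \<union> R)) (Poly_Mapping.lookup n v)"
      using extend[of "A \<union> R" v] n1 cl insert.prems insert.hyps assms(1,2) by auto
    moreover have "g (insert v (A \<inter> C \<union> R)) =
        g (A \<inter> C \<union> R) * \<phi> (msum n (A \<inter> C \<union> R)) (Poly_Mapping.lookup n v)"
      using extend[of "A \<inter> C \<union> R" v] n2 cl insert.prems insert.hyps assms(1,2) by auto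
    ultimately show ?case using insert by (simp add: mult_ac)
  qed simp
  moreover have "finite (C - A)"
    using assms(2) finite_V finite_subset by blast
  moreover have "A \<inter> C \<union> (C - A) = C" by blast
  ultimately show ?thesis by (metis Un_Diff_cancel order_refl)
qed

text \<open>The identity of \<open>glue_clique\<close>, telescoped along the ordering.\<close>

lemma perfect_ordering_product:
  assumes po: "perfect_ordering V E Cs"
  shows "g V * (\<Prod>k\<in>{1..<length Cs}. g (clique_sep Cs k)) = (\<Prod>k<length Cs. g (Cs ! k))"
proof -
  let ?U = "\<lambda>k. \<Union>l<k. Cs ! l"
  have clq: "Cs ! k \<subseteq> V" "clique E (Cs ! k)" if "k < length Cs" for k
    using po nth_mem[OF that] by (auto simp: perfect_ordering_def max_cliques_def cliques_eq)
  have EV: "u \<in> V \<and> w \<in> V" if "{u, w} \<in> E" for u w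
    using edges[OF that] by auto
  have step: "g (?U (Suc k)) * g (clique_sep Cs k) = g (?U k) * g (Cs ! k)"
    if "k < length Cs" for k
  proof -
    have "?U (Suc k) = ?U k \<union> Cs ! k" by (auto simp: lessThan_Suc)
    moreover have "clique_sep Cs k = ?U k \<inter> Cs ! k" by (auto simp: clique_sep_def)
    moreover have "?U k \<subseteq> V"
      using that by (intro UN_least clq(1)) simp
    ultimately show ?thesis
      using glue_clique[of "?U k" "Cs ! k"] clq[OF that]
        no_edge_across_clique_sep[OF po finite_V EV that] by auto
  qed
  have "g (?U (Suc m)) * (\<Prod>k\<in>{1..<Suc m}. g (clique_sep Cs k)) = (\<Prod>k<Suc m. g (Cs ! k))"
    if "m < length Cs" for m
    using that
  proof (induction m)
    case 0
    then show ?case by (simp add: lessThan_Suc)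
  next
    case (Suc m)
    have "g (?U (Suc (Suc m))) * (\<Prod>k\<in>{1..<Suc (Suc m)}. g (clique_sep Cs k)) =
        (g (?U (Suc (Suc m))) * g (clique_sep Cs (Suc m))) * (\<Prod>k\<in>{1..<Suc m}. g (clique_sep Cs k))"
      by (simp add: prod.atLeastLessThan_Suc mult_ac)
    also have "\<dots> = g (Cs ! Suc m) * (g (?U (Suc m)) * (\<Prod>k\<in>{1..<Suc m}. g (clique_sep Cs k)))"
      by (subst step[OF Suc.prems]) (simp only: mult_ac)
    also have "\<dots> = g (Cs ! Suc m) * (\<Prod>k<Suc m. g (Cs ! k))"
      using Suc by simp
    finally show ?case by (simp add: mult_ac)
  qed
  moreover have "Cs \<noteq> []"
  proof -
    have "{} \<in> cliques V E" by (simp add: cliques_def)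
    from finite_clique_extends_to_max_clique[OF finite_V this] show ?thesis
      using po by (force simp: perfect_ordering_def)
  qed
  then obtain m where "length Cs = Suc m" by (cases Cs) auto
  ultimately show ?thesis
    using Union_perfect_ordering[OF po finite_V] by (metis lessI)
qed

lemma some_perfect_ordering:
  "decomposable V E \<Longrightarrow> perfect_ordering V E (some_perfect_ordering V E)"
  unfolding some_perfect_ordering_def
  using perfect_ordering_exists[OF finite_V _ no_loops_E] by (rule someI_ex)

lemma clique_sep_clique:
  assumes "perfect_ordering V E Cs" and "k < length Cs"
  shows "clique_sep Cs k \<subseteq> V" and "clique E (clique_sep Cs k)"
proof -
  have "Cs ! k \<in> max_cliques V E"
    using assms nth_mem by (auto simp: perfect_ordering_def)
  then have "Cs ! k \<subseteq> V" "clique E (Cs ! k)" by (auto simp: max_cliques_def cliques_eq)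
  moreover have "clique_sep Cs k \<subseteq> Cs ! k" by (auto simp: clique_sep_def)
  ultimately show "clique_sep Cs k \<subseteq> V" "clique E (clique_sep Cs k)"
    using clique_subset by blast+
qed

lemma min_separator_clique:
  assumes "decomposable V E" and "S \<in> min_separators V E"
  shows "S \<subseteq> V \<and> clique E S"
proof -
  have "S \<in> clique_sep (some_perfect_ordering V E) ` {1..<length (some_perfect_ordering V E)}"
    using assms(2) by (simp add: min_separators_def Let_def)
  then obtain k where "S = clique_sep (some_perfect_ordering V E) k"
    and "k \<in> {1..<length (some_perfect_ordering V E)}" by (rule imageE)
  then show ?thesis
    using clique_sep_clique[OF some_perfect_ordering[OF assms(1)]] by simp
qed

text \<open>Where the separator product vanishes, the quotient is 0 by convention; the premise \<open>vanish\<close> makes the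
  left-hand side vanish as well.\<close>

lemma max_clique_quotient:
  assumes dec: "decomposable V E"
    and vanish: "\<And>S. S \<subseteq> V \<Longrightarrow> clique E S \<Longrightarrow> g S = 0 \<Longrightarrow> g V = 0"
  shows "g V = (\<Prod>C\<in>max_cliques V E. g C) / (\<Prod>S\<in>min_separators V E. g S ^ sep_mult V E S)"
proof -
  define Cs where "Cs = some_perfect_ordering V E"
  have po: "perfect_ordering V E Cs"
    unfolding Cs_def by (rule some_perfect_ordering[OF dec])
  let ?I = "{1..<length Cs}" and ?s = "clique_sep Cs"
  have "(\<Prod>k\<in>?I. g (?s k)) = (\<Prod>S\<in>?s ` ?I. \<Prod>k\<in>{k \<in> ?I. ?s k = S}. g (?s k))"
    by (rule prod.image_gen) simp
  also have "\<dots> = (\<Prod>S\<in>?s ` ?I. g S ^ sep_mult V E S)"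
    by (intro prod.cong) (auto simp: sep_mult_def simp flip: Cs_def)
  also have "\<dots> = (\<Prod>S\<in>min_separators V E. g S ^ sep_mult V E S)"
    by (intro prod.mono_neutral_right) (auto simp: min_separators_def empty simp flip: Cs_def)
  finally have seps: "(\<Prod>k\<in>?I. g (?s k)) = (\<Prod>S\<in>min_separators V E. g S ^ sep_mult V E S)" .
  have "(\<Prod>k<length Cs. g (Cs ! k)) = (\<Prod>C\<in>set Cs. g C)"
    using po by (intro prod.reindex_bij_betw bij_betw_nth) (auto simp: perfect_ordering_def)
  then have cls: "(\<Prod>k<length Cs. g (Cs ! k)) = (\<Prod>C\<in>max_cliques V E. g C)"
    using po by (simp add: perfect_ordering_def)
  show ?thesis
  proof (cases "(\<Prod>k\<in>?I. g (?s k)) = 0")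
    case True
    then obtain k where k: "k \<in> ?I" "g (?s k) = 0" by auto
    then have "?s k \<subseteq> V" "clique E (?s k)" using clique_sep_clique[OF po] by auto
    with vanish k have "g V = 0" by blast
    moreover from True have "(\<Prod>S\<in>min_separators V E. g S ^ sep_mult V E S) = 0"
      unfolding seps .
    ultimately show ?thesis by simp
  next
    case False
    with perfect_ordering_product[OF po] show ?thesis
      unfolding seps cls by (metis nonzero_mult_div_cancel_right)
  qed
qed

end

section \<open>Coefficients of powers of the graph polynomials\<close>

text \<open>The exponent of the monomial \<open>\<Prod>i\<in>C. x\<^sub>i\<close>.\<close>

definition vertex_index :: "'a set \<Rightarrow> ('a \<Rightarrow>\<^sub>0 nat)" where
  "vertex_index C = (\<Sum>i\<in>C. Poly_Mapping.single i 1)"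

text \<open>The coefficients for the subgraph on \<open>W\<close> vanish at every exponent whose support leaves \<open>W\<close>, so the
  multi-index is cut down together with the graph.\<close>

definition restrict_index :: "('a \<Rightarrow>\<^sub>0 nat) \<Rightarrow> 'a set \<Rightarrow> ('a \<Rightarrow>\<^sub>0 nat)" where
  "restrict_index n W = (\<Sum>i\<in>W. Poly_Mapping.single i (Poly_Mapping.lookup n i))"

definition indep_sets :: "'a set set \<Rightarrow> 'a set \<Rightarrow> 'a set set" where
  "indep_sets E W = {I. I \<subseteq> W \<and> (\<forall>i\<in>I. \<forall>j\<in>I. i \<noteq> j \<longrightarrow> {i, j} \<notin> E)}"

lemma lookup_vertex_index:
  "finite C \<Longrightarrow> Poly_Mapping.lookup (vertex_index C) i = (if i \<in> C then 1 else 0)"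
  by (simp add: vertex_index_def lookup_sum lookup_single when_def sum.delta)

lemma lookup_restrict_index:
  "finite W \<Longrightarrow> Poly_Mapping.lookup (restrict_index n W) i = (if i \<in> W then Poly_Mapping.lookup n i else 0)"
  by (simp add: restrict_index_def lookup_sum lookup_single when_def sum.delta)

lemma restrict_index_self:
  "finite V \<Longrightarrow> Poly_Mapping.keys n \<subseteq> V \<Longrightarrow> restrict_index n V = n"
  by (rule poly_mapping_eqI) (auto simp: lookup_restrict_index in_keys_iff)

lemma msum_restrict_index: "finite W \<Longrightarrow> msum (restrict_index n W) W = msum n W"
  by (simp add: msum_def lookup_restrict_index)

lemma msum_insert:
  "finite W \<Longrightarrow> v \<notin> W \<Longrightarrow> msum n (insert v W) = Poly_Mapping.lookup n v + msum n W"
  by (simp add: msum_def)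

lemma msum_sum_vertex_index:
  assumes "finite W" and "\<And>j. j \<in> J \<Longrightarrow> f j \<subseteq> W"
  shows "msum (\<Sum>j\<in>J. vertex_index (f j)) W = (\<Sum>j\<in>J. card (f j))"
proof -
  have "msum (\<Sum>j\<in>J. vertex_index (f j)) W =
      (\<Sum>j\<in>J. \<Sum>i\<in>W. Poly_Mapping.lookup (vertex_index (f j)) i)"
    unfolding msum_def lookup_sum by (rule sum.swap)
  also have "\<dots> = (\<Sum>j\<in>J. card (f j))"
  proof (rule sum.cong[OF refl])
    fix j assume "j \<in> J"
    then have "f j \<subseteq> W" by (rule assms(2))
    moreover from this have "finite (f j)" using assms(1) finite_subset by blast
    ultimately show "(\<Sum>i\<in>W. Poly_Mapping.lookup (vertex_index (f j)) i) = card (f j)"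
      using assms(1) by (simp add: lookup_vertex_index sum.If_cases Int_absorb1)
  qed
  finally show ?thesis .
qed

lemma prod_single:
  "finite J \<Longrightarrow> (\<Prod>j\<in>J. Poly_Mapping.single (a j) (b j)) =
     Poly_Mapping.single (\<Sum>j\<in>J. a j) (\<Prod>j\<in>J. b j :: real)"
  by (induction J rule: finite_induct) (simp_all add: mult_single)

lemma prod_var: "(\<Prod>i\<in>C. var i) = Poly_Mapping.single (vertex_index C) 1"
  by (cases "finite C") (simp_all add: var_def vertex_index_def prod_single)

text \<open>The ways to write the monomial with exponent \<open>m\<close> as an ordered product of \<open>k\<close> monomials
  \<open>\<Prod>i\<in>C. x\<^sub>i\<close> with \<open>C \<in> F\<close>.\<close>

definition factorizations :: "'a set set \<Rightarrow> nat \<Rightarrow> ('a \<Rightarrow>\<^sub>0 nat) \<Rightarrow> (nat \<Rightarrow> 'a set) set" where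
  "factorizations F k m = {f \<in> {..<k} \<rightarrow>\<^sub>E F. (\<Sum>j<k. vertex_index (f j)) = m}"

text \<open>Every factorization of a monomial of degree \<open>d\<close> into square-free monomials carries the same weight
  \<open>c ^ d\<close>. The case \<open>c = 1\<close> serves for \<open>delta_poly\<close> and the case \<open>c = - 1\<close> for \<open>Delta_poly\<close>.\<close>

lemma lookup_power_weighted_sum:
  assumes "finite W" and "F \<subseteq> Pow W"
  shows "Poly_Mapping.lookup ((\<Sum>C\<in>F. Poly_Mapping.single (vertex_index C) (c ^ card C)) ^ k) m =
    c ^ msum m W * real (card (factorizations F k m))"
proof -
  have finF: "finite F" using assms by (meson finite_Pow_iff finite_subset)
  have "(\<Sum>C\<in>F. Poly_Mapping.single (vertex_index C) (c ^ card C)) ^ k =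
      (\<Prod>j<k. \<Sum>C\<in>F. Poly_Mapping.single (vertex_index C) (c ^ card C))"
    by simp
  also have "\<dots> = (\<Sum>f\<in>{..<k} \<rightarrow>\<^sub>E F. \<Prod>j<k. Poly_Mapping.single (vertex_index (f j)) (c ^ card (f j)))"
    using finF by (intro prod_sum_PiE) auto
  also have "\<dots> = (\<Sum>f\<in>{..<k} \<rightarrow>\<^sub>E F.
      Poly_Mapping.single (\<Sum>j<k. vertex_index (f j)) (c ^ (\<Sum>j<k. card (f j))))"
    by (simp add: prod_single power_sum)
  finally have "Poly_Mapping.lookup ((\<Sum>C\<in>F. Poly_Mapping.single (vertex_index C) (c ^ card C)) ^ k) m =
      (\<Sum>f\<in>{..<k} \<rightarrow>\<^sub>E F. if (\<Sum>j<k. vertex_index (f j)) = m then c ^ (\<Sum>j<k. card (f j)) else 0)"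
    by (simp add: lookup_sum lookup_single when_def)
  also have "\<dots> = (\<Sum>f\<in>factorizations F k m. c ^ (\<Sum>j<k. card (f j)))"
    using finF by (simp add: factorizations_def sum.inter_filter finite_PiE)
  also have "\<dots> = (\<Sum>f\<in>factorizations F k m. c ^ msum m W)"
  proof (rule sum.cong[OF refl])
    fix f assume f: "f \<in> factorizations F k m"
    then have "f j \<subseteq> W" if "j \<in> {..<k}" for j
      using assms(2) that by (auto simp: factorizations_def PiE_iff)
    with f show "c ^ (\<Sum>j<k. card (f j)) = c ^ msum m W"
      using msum_sum_vertex_index[OF assms(1), of "{..<k}" f] by (simp add: factorizations_def)
  qed
  finally show ?thesis by simp
qed

lemma independent_sets_are_complement_cliques:
  "cliques W (complement_edges W E) = indep_sets E W"
  by (auto simp: cliques_def indep_sets_def complement_edges_def)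

lemma indep_sets_Pow: "indep_sets E W \<subseteq> Pow W"
  by (auto simp: indep_sets_def)

lemma finite_indep_sets: "finite W \<Longrightarrow> finite (indep_sets E W)"
  by (meson finite_Pow_iff finite_subset indep_sets_Pow)

lemma delta_poly_eq:
  "delta_poly W E = (\<Sum>C\<in>indep_sets E W. Poly_Mapping.single (vertex_index C) (1 ^ card C))"
  by (simp add: delta_poly_def prod_var independent_sets_are_complement_cliques)

lemma Delta_poly_eq:
  "Delta_poly W E = (\<Sum>C\<in>indep_sets E W. Poly_Mapping.single (vertex_index C) ((- 1) ^ card C))"
proof -
  have "(- 1) ^ k = (Poly_Mapping.single 0 ((- 1) ^ k) :: 'a mpol)" for k
  proof (induction k)
    case (Suc k)
    then show ?case by (simp add: single_uminus)
  qed simp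
  then show ?thesis
    by (simp add: Delta_poly_def prod_var independent_sets_are_complement_cliques mult_single)
qed

lemma remove_empty_set_term:
  assumes "finite W"
  shows "(\<Sum>C\<in>indep_sets E W. Poly_Mapping.single (vertex_index C) (c ^ card C :: real)) - 1 =
    (\<Sum>C\<in>indep_sets E W - {{}}. Poly_Mapping.single (vertex_index C) (c ^ card C))"
proof -
  have "{} \<in> indep_sets E W" by (simp add: indep_sets_def)
  with finite_indep_sets[OF assms] show ?thesis
    by (simp add: sum.remove[of _ "{}"] vertex_index_def)
qed

text \<open>The coefficient of \<open>x\<^sup>m\<close> in the formal power \<open>\<delta>\<^sub>G(x)\<^sup>t\<close>, expanded as a binomial series in \<open>\<delta>\<^sub>G(x) - 1\<close>.
  For fixed \<open>m\<close> it is a polynomial in \<open>t\<close>.\<close>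

definition power_coeff :: "'a set set \<Rightarrow> 'a set \<Rightarrow> ('a \<Rightarrow>\<^sub>0 nat) \<Rightarrow> real \<Rightarrow> real" where
  "power_coeff E W m t =
     (\<Sum>k\<le>msum m W. (t gchoose k) * real (card (factorizations (indep_sets E W - {{}}) k m)))"

text \<open>Each nonempty set contributes at least 1 to the degree. So the series defining
  \<open>graph_neg_multinomial\<close> stops at the degree of \<open>m\<close>.\<close>

lemma no_long_factorizations:
  assumes "finite W" and "msum m W < k"
  shows "factorizations (indep_sets E W - {{}}) k m = {}"
proof -
  have False if f: "f \<in> factorizations (indep_sets E W - {{}}) k m" for f
  proof -
    have fj: "f j \<subseteq> W" "f j \<noteq> {}" if "j \<in> {..<k}" for j
      using f that indep_sets_Pow[of E W] by (auto simp: factorizations_def PiE_iff)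
    have "msum m W = (\<Sum>j<k. card (f j))"
      using msum_sum_vertex_index[OF assms(1), of "{..<k}" f] fj(1) f by (simp add: factorizations_def)
    moreover have "(\<Sum>j<k. 1) \<le> (\<Sum>j<k. card (f j))"
      using fj assms(1) finite_subset by (intro sum_mono) (fastforce simp: Suc_le_eq card_gt_0_iff)
    ultimately show False using assms(2) by simp
  qed
  then show ?thesis by blast
qed

lemma lookup_of_nat_mult:
  "Poly_Mapping.lookup (of_nat c * p) m = real c * Poly_Mapping.lookup (p :: 'a mpol) m"
  by (induction c) (simp_all add: distrib_right lookup_add)

text \<open>The binomial theorem for \<open>\<delta>\<^sub>G = 1 + (\<delta>\<^sub>G - 1)\<close>.\<close>

lemma graph_multinomial_eq_power_coeff:
  assumes "finite W"
  shows "graph_multinomial W E r m = power_coeff E W m (real r)"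
proof -
  let ?N = "\<lambda>k. real (card (factorizations (indep_sets E W - {{}}) k m))"
  let ?M = "msum m W"
  have "Pow W \<supseteq> indep_sets E W - {{}}" using indep_sets_Pow by blast
  then have N: "Poly_Mapping.lookup ((delta_poly W E - 1) ^ k) m = ?N k" for k
    unfolding delta_poly_eq remove_empty_set_term[OF assms]
    by (subst lookup_power_weighted_sum[OF assms]) auto
  have "delta_poly W E ^ r = ((delta_poly W E - 1) + 1) ^ r" by simp
  also have "\<dots> = (\<Sum>k\<le>r. of_nat (r choose k) * (delta_poly W E - 1) ^ k)"
    by (subst binomial_ring) simp
  finally have "graph_multinomial W E r m = (\<Sum>k\<le>r. real (r choose k) * ?N k)"
    by (simp add: graph_multinomial_def lookup_sum lookup_of_nat_mult N)
  also have "\<dots> = (\<Sum>k\<le>max r ?M. real (r choose k) * ?N k)"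
    by (rule sum.mono_neutral_left) auto
  also have "\<dots> = (\<Sum>k\<le>?M. real (r choose k) * ?N k)"
    by (rule sum.mono_neutral_right) (use no_long_factorizations[OF assms] in auto)
  finally show ?thesis by (simp add: power_coeff_def binomial_gbinomial)
qed

lemma graph_neg_multinomial_eq_power_coeff:
  assumes "finite W"
  shows "graph_neg_multinomial W E s m = (- 1) ^ msum m W * power_coeff E W m (- s)"
proof -
  let ?N = "\<lambda>k. real (card (factorizations (indep_sets E W - {{}}) k m))"
  let ?M = "msum m W"
  have "Pow W \<supseteq> indep_sets E W - {{}}" using indep_sets_Pow by blast
  then have N: "Poly_Mapping.lookup ((Delta_poly W E - 1) ^ k) m = (- 1) ^ ?M * ?N k" for k
    unfolding Delta_poly_eq remove_empty_set_term[OF assms]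
    by (subst lookup_power_weighted_sum[OF assms]) auto
  have "graph_neg_multinomial W E s m = (\<Sum>k\<le>?M. (- s gchoose k) * ((- 1) ^ ?M * ?N k))"
    unfolding graph_neg_multinomial_def N
    by (rule suminf_finite) (use no_long_factorizations[OF assms] in auto)
  then show ?thesis
    by (simp add: power_coeff_def sum_distrib_left mult_ac)
qed

text \<open>Proper multicolourings, in which a vertex carries several colours at once.\<close>

definition colourings :: "'a set set \<Rightarrow> ('a \<Rightarrow>\<^sub>0 nat) \<Rightarrow> nat \<Rightarrow> 'a set \<Rightarrow> ('a \<Rightarrow> nat set) set" where
  "colourings E n r W = {A \<in> \<Pi>\<^sub>E i\<in>W. {B. B \<subseteq> {..<r} \<and> card B = Poly_Mapping.lookup n i}.
     \<forall>i\<in>W. \<forall>j\<in>W. {i, j} \<in> E \<longrightarrow> A i \<inter> A j = {}}"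

lemma finite_colourings: "finite W \<Longrightarrow> finite (colourings E n r W)"
  unfolding colourings_def
  by (rule finite_subset[OF Collect_restrict]) (auto intro!: finite_PiE)

text \<open>Choosing a monomial in each of the \<open>r\<close> factors of \<open>\<delta>\<^sub>G(y)\<^sup>r\<close> means choosing, for each colour \<open>j < r\<close>, an
  independent set \<open>f j\<close> of vertices that carry \<open>j\<close>. Listing the colours of each vertex instead is the
  transposed description of the same incidence relation.\<close>

lemma graph_multinomial_counts_colourings:
  assumes "finite W" and lf: "no_loops E"
  shows "graph_multinomial W E r (restrict_index n W) = real (card (colourings E n r W))"
proof -
  let ?m = "restrict_index n W"
  have "graph_multinomial W E r ?m = real (card (factorizations (indep_sets E W) r ?m))"
    unfolding graph_multinomial_def delta_poly_eq
    by (subst lookup_power_weighted_sum[OF assms(1) indep_sets_Pow]) simp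
  also have "card (factorizations (indep_sets E W) r ?m) = card (colourings E n r W)"
  proof (rule bij_betw_same_card[OF bij_betw_byWitness
        [where f = "\<lambda>f. \<lambda>i\<in>W. {j\<in>{..<r}. i \<in> f j}" and f' = "\<lambda>A. \<lambda>j\<in>{..<r}. {i\<in>W. j \<in> A i}"]])
    have count: "Poly_Mapping.lookup (\<Sum>j<r. vertex_index (f j)) i = card {j\<in>{..<r}. i \<in> f j}"
      if "\<And>j. j < r \<Longrightarrow> f j \<subseteq> W" for f :: "nat \<Rightarrow> 'a set" and i
    proof -
      have "Poly_Mapping.lookup (\<Sum>j<r. vertex_index (f j)) i = (\<Sum>j<r. if i \<in> f j then 1 else 0)"
        unfolding lookup_sum
      proof (rule sum.cong[OF refl])
        fix j assume "j \<in> {..<r}"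
        then have "finite (f j)" using that assms(1) finite_subset by blast
        then show "Poly_Mapping.lookup (vertex_index (f j)) i = (if i \<in> f j then 1 else 0)"
          by (rule lookup_vertex_index)
      qed
      then show ?thesis by (simp add: sum.If_cases Int_def)
    qed
    have f_sub: "f j \<subseteq> W" "i \<in> f j \<Longrightarrow> i' \<in> f j \<Longrightarrow> {i, i'} \<notin> E"
      if "f \<in> factorizations (indep_sets E W) r ?m" "j < r" for f j i i'
    proof -
      have "f j \<in> indep_sets E W" using that by (auto simp: factorizations_def PiE_iff)
      then show "f j \<subseteq> W" "i \<in> f j \<Longrightarrow> i' \<in> f j \<Longrightarrow> {i, i'} \<notin> E"
        using lf by (cases "i = i'"; auto simp: indep_sets_def no_loops_def)+
    qed
    show "\<forall>f\<in>factorizations (indep_sets E W) r ?m.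
        (\<lambda>j\<in>{..<r}. {i \<in> W. j \<in> (\<lambda>i\<in>W. {j \<in> {..<r}. i \<in> f j}) i}) = f"
    proof
      fix f assume f: "f \<in> factorizations (indep_sets E W) r ?m"
      then have "f \<in> extensional {..<r}" by (simp add: factorizations_def PiE_iff)
      with f_sub(1)[OF f] show "(\<lambda>j\<in>{..<r}. {i \<in> W. j \<in> (\<lambda>i\<in>W. {j \<in> {..<r}. i \<in> f j}) i}) = f"
        by (intro extensionalityI[of _ "{..<r}"]) auto
    qed
    show "\<forall>A\<in>colourings E n r W. (\<lambda>i\<in>W. {j \<in> {..<r}. i \<in> (\<lambda>j\<in>{..<r}. {i \<in> W. j \<in> A i}) j}) = A"
    proof
      fix A assume A: "A \<in> colourings E n r W"
      then have "A \<in> extensional W" "\<And>i. i \<in> W \<Longrightarrow> A i \<subseteq> {..<r}"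
        by (auto simp: colourings_def PiE_iff)
      then show "(\<lambda>i\<in>W. {j \<in> {..<r}. i \<in> (\<lambda>j\<in>{..<r}. {i \<in> W. j \<in> A i}) j}) = A"
        by (intro extensionalityI[of _ W]) auto
    qed
    show "(\<lambda>f. \<lambda>i\<in>W. {j \<in> {..<r}. i \<in> f j}) ` factorizations (indep_sets E W) r ?m \<subseteq> colourings E n r W"
    proof (rule image_subsetI)
      fix f assume f: "f \<in> factorizations (indep_sets E W) r ?m"
      have "card {j \<in> {..<r}. i \<in> f j} = Poly_Mapping.lookup n i" if "i \<in> W" for i
        using count[of f i] f_sub(1)[OF f] f that assms(1)
        by (simp add: factorizations_def lookup_restrict_index)
      then show "(\<lambda>i\<in>W. {j \<in> {..<r}. i \<in> f j}) \<in> colourings E n r W"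
        using f_sub(2)[OF f] by (auto simp: colourings_def)
    qed
    show "(\<lambda>A. \<lambda>j\<in>{..<r}. {i \<in> W. j \<in> A i}) ` colourings E n r W \<subseteq> factorizations (indep_sets E W) r ?m"
    proof (rule image_subsetI)
      fix A assume A: "A \<in> colourings E n r W"
      let ?f = "\<lambda>j\<in>{..<r}. {i \<in> W. j \<in> A i}"
      have "(\<Sum>j<r. vertex_index (?f j)) = ?m"
      proof (rule poly_mapping_eqI)
        fix i
        have "Poly_Mapping.lookup (\<Sum>j<r. vertex_index (?f j)) i = card {j \<in> {..<r}. i \<in> ?f j}"
          by (rule count) auto
        also have "{j \<in> {..<r}. i \<in> ?f j} = (if i \<in> W then A i else {})"
          using A by (auto simp: colourings_def PiE_iff)
        also have "card \<dots> = Poly_Mapping.lookup ?m i"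
          using A assms(1) by (auto simp: colourings_def PiE_iff lookup_restrict_index)
        finally show "Poly_Mapping.lookup (\<Sum>j<r. vertex_index (?f j)) i = Poly_Mapping.lookup ?m i" .
      qed
      moreover have "{i, i'} \<notin> E" if "i \<in> W" "i' \<in> W" "j \<in> A i" "j \<in> A i'" for i i' j
        using A that unfolding colourings_def by blast
      then have "?f \<in> {..<r} \<rightarrow>\<^sub>E indep_sets E W"
        by (auto simp: indep_sets_def)
      ultimately show "?f \<in> factorizations (indep_sets E W) r ?m"
        by (simp add: factorizations_def)
    qed
  qed
  finally show ?thesis .
qed

text \<open>The colour sets on the clique \<open>nbrs E W v\<close> are disjoint, so they use up exactly as many colours as
  their total weight, whichever colouring of \<open>W\<close> is given. This is where the neighbours of \<open>v\<close> have to be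
  pairwise adjacent. If the weight exceeds \<open>r\<close>, then \<open>W\<close> has no colouring and both sides are 0.\<close>

lemma card_colourings_insert:
  assumes fin: "finite W" and lf: "no_loops E" and v: "v \<notin> W" and cl: "clique E (nbrs E W v)"
  shows "card (colourings E n r (insert v W)) = card (colourings E n r W) *
    int_binomial (int r - int (msum n (nbrs E W v))) (Poly_Mapping.lookup n v)"
proof -
  let ?K = "nbrs E W v"
  let ?free = "\<lambda>A. {B. B \<subseteq> {..<r} - (\<Union>u\<in>?K. A u) \<and> card B = Poly_Mapping.lookup n v}"
  have finK: "finite ?K" using fin by (simp add: nbrs_def)
  have vv: "{v} \<notin> E" using lf by (simp add: no_loops_def)
  have "bij_betw (\<lambda>A. (restrict A W, A v)) (colourings E n r (insert v W))
      (SIGMA A:colourings E n r W. ?free A)"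
  proof (rule bij_betw_byWitness[where f' = "\<lambda>(A, B). A(v := B)"])
    show "\<forall>A\<in>colourings E n r (insert v W). (\<lambda>(A, B). A(v := B)) (restrict A W, A v) = A"
      using v by (auto simp: colourings_def PiE_iff extensional_def restrict_def fun_eq_iff)
    show "\<forall>p\<in>SIGMA A:colourings E n r W. ?free A.
        (restrict ((\<lambda>(A, B). A(v := B)) p) W, ((\<lambda>(A, B). A(v := B)) p) v) = p"
      using v by (auto simp: colourings_def PiE_iff extensional_def restrict_def fun_eq_iff)
    show "(\<lambda>A. (restrict A W, A v)) ` colourings E n r (insert v W) \<subseteq>
        (SIGMA A:colourings E n r W. ?free A)"
    proof (rule image_subsetI)
      fix A assume A: "A \<in> colourings E n r (insert v W)"
      have "A v \<inter> A u = {}" if "u \<in> ?K" for u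
        using A that by (auto simp: colourings_def nbrs_def insert_commute)
      then show "(restrict A W, A v) \<in> (SIGMA A:colourings E n r W. ?free A)"
        using A by (auto simp: colourings_def PiE_iff nbrs_def)
    qed
    show "(\<lambda>(A, B). A(v := B)) ` (SIGMA A:colourings E n r W. ?free A) \<subseteq>
        colourings E n r (insert v W)"
    proof (rule image_subsetI, clarify)
      fix A B assume A: "A \<in> colourings E n r W"
        and B: "B \<subseteq> {..<r} - (\<Union>u\<in>?K. A u)" "card B = Poly_Mapping.lookup n v"
      have "B \<inter> A u = {}" if "u \<in> W" "{u, v} \<in> E" for u
        using B that by (auto simp: nbrs_def)
      with A B v vv show "A(v := B) \<in> colourings E n r (insert v W)"
        by (auto simp: colourings_def PiE_iff extensional_def insert_commute)
    qed
  qed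
  then have "card (colourings E n r (insert v W)) =
      card (SIGMA A:colourings E n r W. ?free A)"
    by (rule bij_betw_same_card)
  also have "\<dots> = (\<Sum>A\<in>colourings E n r W. card (?free A))"
    using finite_colourings[OF fin] by (intro card_SigmaI) auto
  also have "\<dots> = (\<Sum>A\<in>colourings E n r W.
      int_binomial (int r - int (msum n ?K)) (Poly_Mapping.lookup n v))"
  proof (rule sum.cong[OF refl])
    fix A assume A: "A \<in> colourings E n r W"
    have sub: "A u \<subseteq> {..<r}" "card (A u) = Poly_Mapping.lookup n u" if "u \<in> ?K" for u
      using A that by (auto simp: colourings_def PiE_iff nbrs_def)
    have disj: "A u \<inter> A w = {}" if "u \<in> ?K" "w \<in> ?K" "u \<noteq> w" for u w
    proof -
      have "{u, w} \<in> E" "u \<in> W" "w \<in> W" using cl that by (auto simp: clique_def nbrs_def)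
      with A show ?thesis by (simp add: colourings_def)
    qed
    have fA: "finite (A u)" if "u \<in> ?K" for u
      using sub(1)[OF that] finite_subset by blast
    have U: "card (\<Union>u\<in>?K. A u) = msum n ?K"
      using card_UN_disjoint[of ?K A] finK fA disj sub(2) by (simp add: msum_def)
    have Usub: "(\<Union>u\<in>?K. A u) \<subseteq> {..<r}" using sub(1) by blast
    then have le: "msum n ?K \<le> r"
      using card_mono[of "{..<r}" "\<Union>u\<in>?K. A u"] U by simp
    have "card (?free A) = (r - msum n ?K) choose Poly_Mapping.lookup n v"
      using n_subsets[of "{..<r} - (\<Union>u\<in>?K. A u)"] Usub U finK fA
      by (simp add: card_Diff_subset)
    with le show "card (?free A) = int_binomial (int r - int (msum n ?K)) (Poly_Mapping.lookup n v)"
      by (simp add: int_binomial_def nat_diff_distrib)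
  qed
  finally show ?thesis by simp
qed

lemma graph_multinomial_insert:
  assumes fin: "finite W" and lf: "no_loops E" and v: "v \<notin> W" and cl: "clique E (nbrs E W v)"
  shows "graph_multinomial (insert v W) E r (restrict_index n (insert v W)) =
    graph_multinomial W E r (restrict_index n W) *
    real (int_binomial (int r - int (msum n (nbrs E W v))) (Poly_Mapping.lookup n v))"
  using card_colourings_insert[OF assms, of n r] fin lf
  by (simp add: graph_multinomial_counts_colourings)

lemma gbinomial_is_poly: "\<exists>p. \<forall>t. poly p t = (t - c gchoose k)" for c :: real
proof (intro exI allI)
  fix t :: real
  show "poly (smult (1 / fact k) (\<Prod>i\<in>{0..<k}. [:- c - real i, 1:])) t = (t - c gchoose k)"
    by (simp add: gbinomial_prod_rev poly_prod algebra_simps)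
qed

lemma power_coeff_is_poly: "\<exists>p. \<forall>t. poly p t = power_coeff E W m t"
proof -
  obtain q where q: "\<And>k t. poly (q k) t = (t gchoose k :: real)"
    using gbinomial_is_poly[of 0] by (metis diff_zero)
  have "poly (\<Sum>k\<le>msum m W. smult (real (card (factorizations (indep_sets E W - {{}}) k m))) (q k)) t =
      power_coeff E W m t" for t
    by (simp add: power_coeff_def poly_sum q mult.commute)
  then show ?thesis by blast
qed

lemma poly_eq_if_eventually_eq_on_nat:
  fixes p q :: "real poly"
  assumes "\<And>r :: nat. r \<ge> N \<Longrightarrow> poly p (real r) = poly q (real r)"
  shows "p = q"
proof (rule ccontr)
  assume "p \<noteq> q"
  then have "finite {x. poly (p - q) x = 0}" by (intro poly_roots_finite) simp
  then have "finite (real ` {N..})"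
    by (rule finite_subset[rotated]) (use assms in auto)
  then show False by (simp add: finite_image_iff infinite_Ici)
qed

text \<open>Both sides are polynomials in \<open>t\<close>, and they agree at all large natural numbers.\<close>

lemma power_coeff_insert:
  assumes fin: "finite W" and lf: "no_loops E" and v: "v \<notin> W" and cl: "clique E (nbrs E W v)"
  shows "power_coeff E (insert v W) (restrict_index n (insert v W)) t =
    power_coeff E W (restrict_index n W) t *
    (t - real (msum n (nbrs E W v)) gchoose Poly_Mapping.lookup n v)"
proof -
  obtain p p' q where
    p: "\<And>t. poly p t = power_coeff E (insert v W) (restrict_index n (insert v W)) t" and
    p': "\<And>t. poly p' t = power_coeff E W (restrict_index n W) t" and
    q: "\<And>t. poly q t = (t - real (msum n (nbrs E W v)) gchoose Poly_Mapping.lookup n v)"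
    using power_coeff_is_poly gbinomial_is_poly by metis
  have "p = p' * q"
  proof (rule poly_eq_if_eventually_eq_on_nat)
    fix r :: nat assume r: "msum n (nbrs E W v) \<le> r"
    then have "real (int_binomial (int r - int (msum n (nbrs E W v))) (Poly_Mapping.lookup n v)) =
        (real r - real (msum n (nbrs E W v)) gchoose Poly_Mapping.lookup n v)"
      by (simp add: int_binomial_def nat_diff_distrib binomial_gbinomial of_nat_diff)
    then show "poly p (real r) = poly (p' * q) (real r)"
      using graph_multinomial_insert[OF assms, of r n] fin
      by (simp add: p p' q graph_multinomial_eq_power_coeff)
  qed
  then show ?thesis by (metis p p' poly_mult q)
qed

lemma negated_gbinomial_eq_real_binomial:
  assumes "s > 0"
  shows "(- 1) ^ m * (- s - real k gchoose m) = real_binomial (real m + real k + s - 1) m"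
proof -
  have "real k + s \<notin> \<int>\<^sub>\<le>\<^sub>0" using assms by (auto elim!: nonpos_Ints_cases)
  then have "pochhammer (real k + s) m = Gamma (real k + s + real m) / Gamma (real k + s)"
    by (rule pochhammer_Gamma)
  then show ?thesis
    by (simp add: gbinomial_pochhammer real_binomial_def add_ac flip: power_mult_distrib)
qed

text \<open>The case \<open>t = - s\<close>. The signs of \<open>\<Delta>\<^sub>G(x) = \<delta>\<^sub>G(- x)\<close> turn the generalized binomial coefficient with
  negative upper argument into a positive one.\<close>

lemma graph_neg_multinomial_insert:
  assumes fin: "finite W" and lf: "no_loops E" and v: "v \<notin> W" and cl: "clique E (nbrs E W v)"
    and s: "s > 0"
  shows "graph_neg_multinomial (insert v W) E s (restrict_index n (insert v W)) =
    graph_neg_multinomial W E s (restrict_index n W) *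
    real_binomial (real (Poly_Mapping.lookup n v) + real (msum n (nbrs E W v)) + s - 1)
      (Poly_Mapping.lookup n v)"
proof -
  have "msum (restrict_index n (insert v W)) (insert v W) =
      Poly_Mapping.lookup n v + msum (restrict_index n W) W"
    using fin by (simp add: msum_restrict_index) (simp add: msum_insert[OF fin v])
  then show ?thesis
    using fin
    by (simp add: graph_neg_multinomial_eq_power_coeff power_coeff_insert[OF fin lf v cl]
        power_add mult_ac flip: negated_gbinomial_eq_real_binomial[OF s])
qed

lemma graph_multinomial_empty: "graph_multinomial {} E r (restrict_index n {}) = 1"
  and graph_neg_multinomial_empty: "graph_neg_multinomial {} E s (restrict_index n {}) = 1"
proof -
  have "factorizations F 0 (restrict_index n {}) = {\<lambda>_. undefined}" for F :: "'a set set"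
    by (simp add: factorizations_def restrict_index_def)
  then have "power_coeff E {} (restrict_index n {}) t = 1" for t
    by (simp add: power_coeff_def msum_def)
  then show "graph_multinomial {} E r (restrict_index n {}) = 1"
    and "graph_neg_multinomial {} E s (restrict_index n {}) = 1"
    by (simp_all add: graph_multinomial_eq_power_coeff graph_neg_multinomial_eq_power_coeff msum_def)
qed

lemma multinomial_insert:
  assumes "finite K" "v \<notin> K"
  shows "multinomial r n (insert v K) = multinomial r n K *
    real (int_binomial (int r - int (msum n K)) (Poly_Mapping.lookup n v))"
proof -
  let ?a = "msum n K" and ?b = "Poly_Mapping.lookup n v"
  consider "?a + ?b \<le> r" | "?a \<le> r" "r < ?a + ?b" | "r < ?a" by linarith
  then show ?thesis
  proof cases
    case 1
    then have "real ((r - ?a) choose ?b) = fact (r - ?a) / (fact ?b * fact (r - (?b + ?a)))"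
      by (simp add: binomial_fact add.commute)
    with 1 assms show ?thesis
      by (simp add: multinomial_def msum_insert int_binomial_def nat_diff_distrib)
  next
    case 2
    with assms show ?thesis
      by (simp add: multinomial_def msum_insert int_binomial_def nat_diff_distrib)
  next
    case 3
    with assms show ?thesis by (simp add: multinomial_def msum_insert)
  qed
qed

lemma neg_multinomial_insert:
  assumes "finite K" "v \<notin> K" "s > 0"
  shows "neg_multinomial s n (insert v K) = neg_multinomial s n K *
    real_binomial (real (Poly_Mapping.lookup n v) + real (msum n K) + s - 1) (Poly_Mapping.lookup n v)"
proof -
  have "Gamma (s + real (msum n K)) \<noteq> 0"
    using assms(3) by (metis Gamma_real_pos add_pos_nonneg less_irrefl of_nat_0_le_iff)
  with assms show ?thesis
    by (simp add: neg_multinomial_def real_binomial_def msum_insert add_ac)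
qed

lemma multinomial_empty: "multinomial r n {} = 1"
  by (simp add: multinomial_def msum_def)

lemma neg_multinomial_empty: "s > 0 \<Longrightarrow> neg_multinomial s n {} = 1"
  by (simp add: neg_multinomial_def msum_def) (metis Gamma_real_pos less_irrefl)

lemma neg_multinomial_pos: "s > 0 \<Longrightarrow> neg_multinomial s n A > 0"
  by (auto simp: neg_multinomial_def intro!: divide_pos_pos mult_pos_pos Gamma_real_pos prod_pos)

text \<open>A colouring restricts to any smaller vertex set.\<close>

lemma graph_multinomial_eq_0_mono:
  assumes "finite W" "S \<subseteq> W" "no_loops E"
    and "graph_multinomial S E r (restrict_index n S) = 0"
  shows "graph_multinomial W E r (restrict_index n W) = 0"
proof -
  have finS: "finite S" using assms(1,2) finite_subset by blast
  have "restrict A S \<in> colourings E n r S" if "A \<in> colourings E n r W" for A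
    using that assms(2) unfolding colourings_def by (auto simp: PiE_iff subset_iff)
  then have "colourings E n r W = {}"
    using assms(4) finite_colourings[OF finS]
    by (auto simp: graph_multinomial_counts_colourings[OF finS assms(3)])
  then show ?thesis
    by (simp add: graph_multinomial_counts_colourings[OF assms(1,3)])
qed

section \<open>The product formulas for the graph multinomial coefficients\<close>

theorem lemma2p15:
  fixes V :: "'a set" and E :: "'a set set" and r :: nat and s :: real
  assumes "finite_simple_graph V E" and "decomposable V E" and "r \<ge> 1" and "s > 0"
  shows "(\<forall>n :: 'a \<Rightarrow>\<^sub>0 nat. Poly_Mapping.keys n \<subseteq> V \<longrightarrow>
            graph_multinomial V E r n =
              (\<Prod>C\<in>max_cliques V E. multinomial r n C) /
              (\<Prod>S\<in>min_separators V E. multinomial r n S ^ sep_mult V E S) \<and>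
            graph_neg_multinomial V E s n =
              (\<Prod>C\<in>max_cliques V E. neg_multinomial s n C) /
              (\<Prod>S\<in>min_separators V E. neg_multinomial s n S ^ sep_mult V E S)) \<and>
         (\<forall>D. moral_dag E D \<longrightarrow> (\<forall>n :: 'a \<Rightarrow>\<^sub>0 nat. Poly_Mapping.keys n \<subseteq> V \<longrightarrow>
            graph_multinomial V E r n =
              (\<Prod>i\<in>V. real (int_binomial (int r - int (msum n (parents D i))) (Poly_Mapping.lookup n i))) \<and>
            graph_neg_multinomial V E s n =
              (\<Prod>i\<in>V. real_binomial
                 (real (Poly_Mapping.lookup n i) + real (msum n (parents D i)) + s - 1) (Poly_Mapping.lookup n i))))"
proof -
  have finV: "finite V" and edges: "\<And>e. e \<in> E \<Longrightarrow> e \<subseteq> V \<and> card e = 2"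
    using assms(1) by (auto simp: finite_simple_graph_def)
  have lf: "no_loops E" using edges by (force simp: no_loops_def)
  have fin: "finite W" if "W \<subseteq> V" for W using that finV finite_subset by blast
  let ?\<phi> = "\<lambda>p m. real (int_binomial (int r - int p) m)"
  let ?\<psi> = "\<lambda>p m. real_binomial (real m + real p + s - 1) m"
  let ?g = "\<lambda>n W. graph_multinomial W E r (restrict_index n W)"
  let ?h = "\<lambda>n W. graph_neg_multinomial W E s (restrict_index n W)"
  have pos: "simplicial_product V E n ?\<phi> (?g n)" for n
    by unfold_locales
      (use finV edges graph_multinomial_empty graph_multinomial_insert[OF fin lf] in auto)
  have neg: "simplicial_product V E n ?\<psi> (?h n)" for n
    by unfold_locales
      (use finV edges graph_neg_multinomial_empty graph_neg_multinomial_insert[OF fin lf _ _ assms(4)] in auto)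
  have g_clique: "?g n C = multinomial r n C" if "C \<subseteq> V" "clique E C" for n C
    by (rule simplicial_product.clique_value[OF pos that])
      (simp_all add: multinomial_empty multinomial_insert)
  have h_clique: "?h n C = neg_multinomial s n C" if "C \<subseteq> V" "clique E C" for n C
    by (rule simplicial_product.clique_value[OF neg that])
      (simp_all add: neg_multinomial_empty neg_multinomial_insert assms(4))
  have max: "C \<subseteq> V \<and> clique E C" if "C \<in> max_cliques V E" for C
    using that by (auto simp: max_cliques_def cliques_eq)
  have sep: "S \<subseteq> V \<and> clique E S" if "S \<in> min_separators V E" for S
    using simplicial_product.min_separator_clique[OF pos assms(2) that] .
  have whole: "restrict_index n V = n" if "Poly_Mapping.keys n \<subseteq> V" for n :: "'a \<Rightarrow>\<^sub>0 nat"
    using restrict_index_self[OF finV that] .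
  have "?g n V = (\<Prod>C\<in>max_cliques V E. ?g n C) / (\<Prod>S\<in>min_separators V E. ?g n S ^ sep_mult V E S)" for n
    by (rule simplicial_product.max_clique_quotient[OF pos assms(2)])
      (rule graph_multinomial_eq_0_mono[OF finV _ lf])
  then have quot: "?g n V = (\<Prod>C\<in>max_cliques V E. multinomial r n C) /
      (\<Prod>S\<in>min_separators V E. multinomial r n S ^ sep_mult V E S)" for n
    using max sep by (simp add: g_clique)
  have "?h n V = (\<Prod>C\<in>max_cliques V E. ?h n C) / (\<Prod>S\<in>min_separators V E. ?h n S ^ sep_mult V E S)" for n
  proof (rule simplicial_product.max_clique_quotient[OF neg assms(2)])
    fix S assume "S \<subseteq> V" "clique E S" "?h n S = 0"
    then show "?h n V = 0" using neg_multinomial_pos[OF assms(4), of n S] by (simp add: h_clique)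
  qed
  then have neg_quot: "?h n V = (\<Prod>C\<in>max_cliques V E. neg_multinomial s n C) /
      (\<Prod>S\<in>min_separators V E. neg_multinomial s n S ^ sep_mult V E S)" for n
    using max sep by (simp add: h_clique)
  have dag: "?g n V = (\<Prod>i\<in>V. ?\<phi> (msum n (parents D i)) (Poly_Mapping.lookup n i))"
    and neg_dag: "?h n V = (\<Prod>i\<in>V. ?\<psi> (msum n (parents D i)) (Poly_Mapping.lookup n i))"
    if "moral_dag E D" for D n
    using simplicial_product.moral_dag_product[OF pos that]
      simplicial_product.moral_dag_product[OF neg that] .
  show ?thesis
  proof (intro conjI allI impI, goal_cases)
    case (1 n)
    then show ?case using quot[of n] by (simp only: whole)
  next
    case (2 n)
    then show ?case using neg_quot[of n] by (simp only: whole)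
  next
    case (3 D n)
    then show ?case using dag[of D n] by (simp only: whole)
  next
    case (4 D n)
    then show ?case using neg_dag[of D n] by (simp only: whole)
  qed
qed

end
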